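(* Let $(M,F)$ be a conic pseudo-Riemannian surface (so $\mathcal I\equiv0$) and $\overline F=e^\phi F$ an anisotropic conformal change. The following are equivalent: (a) $-3\varepsilon Q-3Q_{;2;2}+\varepsilon P_{;2}+P_{;2;2;2}=0$ and $3P+3\varepsilon P_{;2;2}+\varepsilon Q_{;2}+Q_{;2;2;2}=0$; (b) the quantities $$M^i_{jk}=\frac1{F^2}\Big[2(P\ell^i+Qm^i)\ell_j\ell_k+\{(P_{;2}-Q)\ell^i+(\varepsilon P+Q_{;2})m^i\}(\ell_jm_k+\ell_km_j)+\{(\varepsilon P+P_{;2;2}-2Q_{;2})\ell^i+(2\varepsilon P_{;2}+\varepsilon Q+Q_{;2;2})m^i\}m_jm_k\Big]$$ (which equal $\overline G^i_{jk}-G^i_{jk}$) do not depend on $y$, i.e. they define a symmetric $(1,2)$-tensor field on $M$; (c) $\overline F$ is Berwald.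
   Context: Throughout, $M$ is a smooth $2$-dimensional manifold, $TM_0$ its slit tangent bundle with induced local coordinates $(x^i,y^i)$, $\partial_i=\partial/\partial x^i$, $\dot\partial_i=\partial/\partial y^i$. A function is called $h(r)$ if it is positively homogeneous of degree $r$ in $y$. A conic pseudo-Finsler surface $(M,F)$ consists of a conic subbundle $\mathcal A\subset TM_0$ (an open set invariant under $y\mapsto\lambda y$, $\lambda>0$, projecting onto $M$) and a smooth $h(1)$ function $F:\mathcal A\to\mathbb R$ such that $g_{ij}=\frac12\dot\partial_i\dot\partial_jF^2$ is nondegenerate. Put $\ell_i=\dot\partial_iF$, $\ell^i=y^i/F$. Modified Berwald frame: $\varepsilon\in\{1,-1\}$ and a covector $m_i$ satisfy $g_{ij}=\ell_i\ell_j+\varepsilon m_im_j$, $m^i=g^{ij}m_j$, so $\ell^i\ell_i=1$, $\ell^im_i=0$, $m^im_i=\varepsilon$. The main scalar $\mathcal I$ ($h(0)$) is defined by $FC_{ijk}=\mathcal I\,m_im_jm_k$, where $C_{ijk}=\frac14\dot\partial_i\dot\partial_j\dot\partial_kF^2$. The geodesic spray of $F$ is $S=y^i\partial_i-2G^i\dot\partial_i$; $G^i_j=\dot\partial_jG^i$, $G^i_{jk}=\dot\partial_kG^i_j$ (Berwald connection), $\delta_i=\partial_i-G^j_i\dot\partial_j$. For a smooth function $f$: $f_{;1}=y^i\dot\partial_if$, $f_{;2}=\varepsilon Fm^i\dot\partial_if$, $f_{,1}=\ell^i\delta_if$, $f_{,2}=\varepsilon m^i\delta_if$; iterated derivatives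 are read left to right, e.g. $f_{,1;2}=(f_{,1})_{;2}$, $f_{;2;2;2}=((f_{;2})_{;2})_{;2}$. $F$ is (conic pseudo-)Riemannian if $F^2$ is quadratic in $y$, equivalently $\mathcal I\equiv0$. Anisotropic conformal change: $\phi$ is a smooth $h(0)$ function on $\mathcal A$ with $F^2(\dot\partial_i\dot\partial_j\phi+\dot\partial_i\phi\,\dot\partial_j\phi)m^im^j+\varepsilon\ne0$, and $\overline F=e^{\phi}F$. Set $\sigma=\phi_{;2;2}+\varepsilon\mathcal I\phi_{;2}+2(\phi_{;2})^2$, $\rho=1/(\sigma+\varepsilon-(\phi_{;2})^2)$, $2Q=\varepsilon\rho F^2(\phi_{;2}\phi_{,1}+\phi_{,1;2}-2\phi_{,2})$, $2P=-\rho F^2\phi_{;2}(\phi_{;2}\phi_{,1}+\phi_{,1;2}-2\phi_{,2})+F^2\phi_{,1}$. The spray coefficients of $\overline F$ are $\overline G^i=G^i+Qm^i+P\ell^i$, and $\overline G^i_{jk}=\dot\partial_j\dot\partial_k\overline G^i$. $\overline F$ is Berwald iff the $\overline G^i$ are quadratic in $y$.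
   Formalization: Stated in a coordinate chart (M open in R²), with F nonzero; "does not depend on y" and "quadratic in y" (for F² and the spray) are read locally on each fiber, since (a)⇒(b) fails globally if fibers of the conic subbundle are disconnected; for connected fibers the readings agree. *)

theory Defs
  imports "HOL-Analysis.Analysis"
begin

text \<open>Local coordinate setting. A point of the slit tangent bundle over a coordinate
chart is a pair (x,y) with x, y in R^2; indices i range over the type 2.\<close>

type_synonym pt = "(real^2) \<times> (real^2)"
type_synonym fn = "pt \<Rightarrow> real"

definition dirv :: "bool \<Rightarrow> 2 \<Rightarrow> pt" where
  "dirv b i = (if b then (0, axis i 1) else (axis i 1, 0))"

definition pd :: "bool \<Rightarrow> 2 \<Rightarrow> fn \<Rightarrow> fn" where
  "pd b i f p = deriv (\<lambda>t. f (p + t *\<^sub>R dirv b i)) 0"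

abbreviation Dx :: "2 \<Rightarrow> fn \<Rightarrow> fn" where "Dx i \<equiv> pd False i"
abbreviation Dy :: "2 \<Rightarrow> fn \<Rightarrow> fn" where "Dy i \<equiv> pd True i"

fun iter_pd :: "(bool \<times> 2) list \<Rightarrow> fn \<Rightarrow> fn" where
  "iter_pd [] f = f"
| "iter_pd (d # ds) f = pd (fst d) (snd d) (iter_pd ds f)"

definition smooth_on :: "pt set \<Rightarrow> fn \<Rightarrow> bool" where
  "smooth_on A f \<longleftrightarrow>
     (\<forall>ds. continuous_on A (iter_pd ds f) \<and>
        (\<forall>b i. \<forall>p\<in>A. (\<lambda>t. iter_pd ds f (p + t *\<^sub>R dirv b i)) differentiable (at 0)))"

definition conic_set :: "pt set \<Rightarrow> bool" where
  "conic_set A \<longleftrightarrow> open A \<and>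
     (\<forall>x y. (x, y) \<in> A \<longrightarrow> y \<noteq> 0 \<and> (\<forall>c>0. (x, c *\<^sub>R y) \<in> A))"

definition homog :: "pt set \<Rightarrow> nat \<Rightarrow> fn \<Rightarrow> bool" where
  "homog A r f \<longleftrightarrow> (\<forall>x y c. (x, y) \<in> A \<longrightarrow> c > 0 \<longrightarrow> f (x, c *\<^sub>R y) = c ^ r * f (x, y))"

definition quadratic_in_y :: "pt set \<Rightarrow> fn \<Rightarrow> bool" where
  "quadratic_in_y A f \<longleftrightarrow>
     (\<forall>x y0. (x, y0) \<in> A \<longrightarrow> (\<exists>e>0. \<exists>c :: 2 \<Rightarrow> 2 \<Rightarrow> real.
        \<forall>y. (x, y) \<in> A \<and> dist y y0 < e \<longrightarrow> f (x, y) = (\<Sum>j\<in>UNIV. \<Sum>k\<in>UNIV. c j k * y$j * y$k)))"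

definition indep_of_y :: "pt set \<Rightarrow> fn \<Rightarrow> bool" where
  "indep_of_y A f \<longleftrightarrow>
     (\<forall>x y0. (x, y0) \<in> A \<longrightarrow> (\<exists>e>0. \<forall>y. (x, y) \<in> A \<and> dist y y0 < e \<longrightarrow> f (x, y) = f (x, y0)))"

definition sq :: "fn \<Rightarrow> fn" where "sq F = (\<lambda>p. (F p)\<^sup>2)"

definition gmat :: "fn \<Rightarrow> pt \<Rightarrow> real^2^2" where
  "gmat F p = (\<chi> i j. 1/2 * Dy i (Dy j (sq F)) p)"

definition ginv :: "fn \<Rightarrow> pt \<Rightarrow> real^2^2" where
  "ginv F p = matrix_inv (gmat F p)"

definition conic_pseudo_Finsler :: "pt set \<Rightarrow> fn \<Rightarrow> bool" where
  "conic_pseudo_Finsler A F \<longleftrightarrow> conic_set A \<and> smooth_on A F \<and> homog A 1 F \<and>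
     (\<forall>p\<in>A. F p \<noteq> 0 \<and> det (gmat F p) \<noteq> 0)"

definition l_lo :: "fn \<Rightarrow> 2 \<Rightarrow> fn" where "l_lo F i = Dy i F"
definition l_up :: "fn \<Rightarrow> 2 \<Rightarrow> fn" where "l_up F i p = (snd p)$i / F p"
definition m_up :: "fn \<Rightarrow> (2 \<Rightarrow> fn) \<Rightarrow> 2 \<Rightarrow> fn" where
  "m_up F m i p = (\<Sum>j\<in>UNIV. ginv F p $ i $ j * m j p)"

definition berwald_frame :: "pt set \<Rightarrow> fn \<Rightarrow> real \<Rightarrow> (2 \<Rightarrow> fn) \<Rightarrow> bool" where
  "berwald_frame A F eps m \<longleftrightarrow> (eps = 1 \<or> eps = -1) \<and> (\<forall>i. smooth_on A (m i)) \<and>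
     (\<forall>p\<in>A. \<forall>i j. gmat F p $ i $ j = l_lo F i p * l_lo F j p + eps * m i p * m j p)"

definition cartan :: "fn \<Rightarrow> 2 \<Rightarrow> 2 \<Rightarrow> 2 \<Rightarrow> fn" where
  "cartan F i j k = (\<lambda>p. 1/4 * Dy i (Dy j (Dy k (sq F))) p)"

text \<open>Main scalar: F C_ijk = I m_i m_j m_k, hence I = eps F C_ijk m^i m^j m^k.\<close>
definition main_scalar :: "fn \<Rightarrow> real \<Rightarrow> (2 \<Rightarrow> fn) \<Rightarrow> fn" where
  "main_scalar F eps m p = eps * F p *
     (\<Sum>i\<in>UNIV. \<Sum>j\<in>UNIV. \<Sum>k\<in>UNIV. cartan F i j k p * m_up F m i p * m_up F m j p * m_up F m k p)"

definition spray :: "fn \<Rightarrow> 2 \<Rightarrow> fn" where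
  "spray F i p = 1/4 * (\<Sum>l\<in>UNIV. ginv F p $ i $ l *
      ((\<Sum>k\<in>UNIV. (snd p)$k * Dx k (Dy l (sq F)) p) - Dx l (sq F) p))"

definition Gij :: "fn \<Rightarrow> 2 \<Rightarrow> 2 \<Rightarrow> fn" where "Gij F i j = Dy j (spray F i)"

definition delta :: "fn \<Rightarrow> 2 \<Rightarrow> fn \<Rightarrow> fn" where
  "delta F i f p = Dx i f p - (\<Sum>j\<in>UNIV. Gij F j i p * Dy j f p)"

definition sc1 :: "fn \<Rightarrow> fn" where "sc1 f p = (\<Sum>i\<in>UNIV. (snd p)$i * Dy i f p)"
definition sc2 :: "fn \<Rightarrow> real \<Rightarrow> (2 \<Rightarrow> fn) \<Rightarrow> fn \<Rightarrow> fn" where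
  "sc2 F eps m f p = eps * F p * (\<Sum>i\<in>UNIV. m_up F m i p * Dy i f p)"
definition cm1 :: "fn \<Rightarrow> fn \<Rightarrow> fn" where
  "cm1 F f p = (\<Sum>i\<in>UNIV. l_up F i p * delta F i f p)"
definition cm2 :: "fn \<Rightarrow> real \<Rightarrow> (2 \<Rightarrow> fn) \<Rightarrow> fn \<Rightarrow> fn" where
  "cm2 F eps m f p = eps * (\<Sum>i\<in>UNIV. m_up F m i p * delta F i f p)"

definition conf_admissible :: "pt set \<Rightarrow> fn \<Rightarrow> real \<Rightarrow> (2 \<Rightarrow> fn) \<Rightarrow> fn \<Rightarrow> bool" where
  "conf_admissible A F eps m phi \<longleftrightarrow> smooth_on A phi \<and> homog A 0 phi \<and>
     (\<forall>p\<in>A. (F p)\<^sup>2 * (\<Sum>i\<in>UNIV. \<Sum>j\<in>UNIV.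
         (Dy i (Dy j phi) p + Dy i phi p * Dy j phi p) * m_up F m i p * m_up F m j p) + eps \<noteq> 0)"

definition sigma_c :: "fn \<Rightarrow> real \<Rightarrow> (2 \<Rightarrow> fn) \<Rightarrow> fn \<Rightarrow> fn" where
  "sigma_c F eps m phi p = sc2 F eps m (sc2 F eps m phi) p
     + eps * main_scalar F eps m p * sc2 F eps m phi p + 2 * (sc2 F eps m phi p)\<^sup>2"

definition rho_c :: "fn \<Rightarrow> real \<Rightarrow> (2 \<Rightarrow> fn) \<Rightarrow> fn \<Rightarrow> fn" where
  "rho_c F eps m phi p = 1 / (sigma_c F eps m phi p + eps - (sc2 F eps m phi p)\<^sup>2)"

definition Wc :: "fn \<Rightarrow> real \<Rightarrow> (2 \<Rightarrow> fn) \<Rightarrow> fn \<Rightarrow> fn" where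
  "Wc F eps m phi p = sc2 F eps m phi p * cm1 F phi p + sc2 F eps m (cm1 F phi) p - 2 * cm2 F eps m phi p"

definition Qc :: "fn \<Rightarrow> real \<Rightarrow> (2 \<Rightarrow> fn) \<Rightarrow> fn \<Rightarrow> fn" where
  "Qc F eps m phi p = eps * rho_c F eps m phi p * (F p)\<^sup>2 * Wc F eps m phi p / 2"

definition Pc :: "fn \<Rightarrow> real \<Rightarrow> (2 \<Rightarrow> fn) \<Rightarrow> fn \<Rightarrow> fn" where
  "Pc F eps m phi p = (- rho_c F eps m phi p * (F p)\<^sup>2 * sc2 F eps m phi p * Wc F eps m phi p
      + (F p)\<^sup>2 * cm1 F phi p) / 2"

definition Mt :: "fn \<Rightarrow> real \<Rightarrow> (2 \<Rightarrow> fn) \<Rightarrow> fn \<Rightarrow> 2 \<Rightarrow> 2 \<Rightarrow> 2 \<Rightarrow> fn" where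
  "Mt F eps m phi i j k p =
    (let P = Pc F eps m phi; Q = Qc F eps m phi; d = sc2 F eps m;
         li = l_up F i p; mi = m_up F m i p;
         lj = l_lo F j p; lk = l_lo F k p; mj = m j p; mk = m k p in
     1 / (F p)\<^sup>2 *
      (2 * (P p * li + Q p * mi) * lj * lk
       + ((d P p - Q p) * li + (eps * P p + d Q p) * mi) * (lj * mk + lk * mj)
       + ((eps * P p + d (d P) p - 2 * d Q p) * li
          + (2 * eps * d P p + eps * Q p + d (d Q) p) * mi) * mj * mk))"

end

theory Submission
  imports Defs
begin

text \<open>
  Write \<open>d f = f\<^bsub>;2\<^esub>\<close>. For a pseudo-Riemannian \<open>F\<close> the frame obeys
  \<open>d \<ell>\<^sub>j = \<epsilon> m\<^sub>j\<close>, \<open>d m\<^sub>j = - \<ell>\<^sub>j\<close> (and likewise with raised indices), and a function of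
  homogeneity degree \<open>r\<close> satisfies
  \<open>\<partial>f/\<partial>y\<^sup>k = (r f \<ell>\<^sub>k + d f m\<^sub>k) / F\<close>. Put \<open>V\<^sup>i = P \<ell>\<^sup>i + Q m\<^sup>i\<close>.
  Lowering the index of the spray of \<open>e\<^sup>\<phi> F\<close> shows that it equals \<open>G\<^sup>i + V\<^sup>i\<close>. As \<open>V\<^sup>i\<close> has degree 2,
  the frame calculus gives \<open>\<partial>\<^sup>2 V\<^sup>i/\<partial>y\<^sup>j\<partial>y\<^sup>k = M\<^sup>i\<^sub>j\<^sub>k\<close>, which has degree 0, and
  \<open>d M\<^sup>i\<^sub>j\<^sub>k = (d d d V\<^sup>i + 4 \<epsilon> d V\<^sup>i) m\<^sub>j m\<^sub>k / F\<^sup>2\<close>. The components of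
  \<open>d d d V\<^sup>i + 4 \<epsilon> d V\<^sup>i\<close> along \<open>\<ell>\<^sup>i\<close> and \<open>m\<^sup>i\<close> are the two expressions in (a), so (a) says exactly
  that \<open>M\<close> is independent of \<open>y\<close>. Since \<open>G\<^sup>i\<close> is quadratic in \<open>y\<close>, this is also the condition that
  \<open>G\<^sup>i + V\<^sup>i\<close> be quadratic.
\<close>

section \<open>Calculus of iterated partial derivatives\<close>

lemma smooth_on_has_pd:
  assumes "smooth_on A f" "p \<in> A"
  shows "((\<lambda>t. f (p + t *\<^sub>R dirv b i)) has_real_derivative pd b i f p) (at 0)"
proof -
  have "\<forall>b i. \<forall>p\<in>A. (\<lambda>t. iter_pd [] f (p + t *\<^sub>R dirv b i)) differentiable (at 0)"
    using assms(1) unfolding smooth_on_def by blast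
  then show ?thesis
    using assms(2) by (simp add: pd_def DERIV_deriv_iff_real_differentiable)
qed

lemma smooth_on_has_pd_shift:
  assumes "smooth_on A f" "p + t *\<^sub>R dirv b i \<in> A"
  shows "((\<lambda>t. f (p + t *\<^sub>R dirv b i)) has_real_derivative pd b i f (p + t *\<^sub>R dirv b i)) (at t)"
proof -
  have "((\<lambda>s. f (p + t *\<^sub>R dirv b i + s *\<^sub>R dirv b i)) has_real_derivative
      pd b i f (p + t *\<^sub>R dirv b i)) (at 0)"
    using assms by (rule smooth_on_has_pd)
  then have "((\<lambda>s. f (p + (t + s) *\<^sub>R dirv b i)) has_real_derivative
      pd b i f (p + t *\<^sub>R dirv b i)) (at 0)"
    by (simp add: algebra_simps)
  then show ?thesis
    by (simp add: DERIV_shift[of "\<lambda>t. f (p + t *\<^sub>R dirv b i)" _ 0 t, simplified] add.commute)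
qed

lemma pd_eqI:
  "((\<lambda>t. f (p + t *\<^sub>R dirv b i)) has_real_derivative D) (at 0) \<Longrightarrow> pd b i f p = D"
  by (simp add: pd_def DERIV_imp_deriv)

lemma eventually_line_in_open:
  fixes p v :: "'a::real_normed_vector"
  assumes "open A" "p \<in> A"
  shows "eventually (\<lambda>t. p + t *\<^sub>R v \<in> A) (nhds 0)"
proof -
  have "continuous_on UNIV (\<lambda>t::real. p + t *\<^sub>R v)" by (intro continuous_intros)
  then have "open ((\<lambda>t::real. p + t *\<^sub>R v) -` A)" using assms(1) by (rule open_vimage[rotated])
  then show ?thesis using assms(2) by (auto simp: eventually_nhds intro!: exI[of _ "(\<lambda>t::real. p + t *\<^sub>R v) -` A"])
qed

lemma pd_cong:
  assumes "open A" "p \<in> A" "\<And>q. q \<in> A \<Longrightarrow> f q = g q"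
  shows "pd b i f p = pd b i g p"
  unfolding pd_def
  by (rule deriv_cong_ev[OF eventually_mono[OF eventually_line_in_open[OF assms(1,2)]]], rule assms(3)) simp_all

lemma Dy_cong_slice:
  assumes "open U" "y \<in> U" "\<And>y. y \<in> U \<Longrightarrow> f (x, y) = g (x, y)"
  shows "Dy i f (x, y) = Dy i g (x, y)"
  unfolding pd_def
  by (rule deriv_cong_ev[OF eventually_mono[OF eventually_line_in_open[OF assms(1,2), of "axis i 1"]]])
     (auto simp: dirv_def assms(3))

lemma iter_pd_append: "iter_pd (ds @ es) f = iter_pd ds (iter_pd es f)"
  by (induction ds) auto

lemma smooth_on_pd: "smooth_on A f \<Longrightarrow> smooth_on A (pd b i f)"
  unfolding smooth_on_def
  using iter_pd_append[of _ "[(b, i)]" f] by simp metis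

lemma smooth_on_imp_continuous_on: "smooth_on A f \<Longrightarrow> continuous_on A f"
  unfolding smooth_on_def by (metis iter_pd.simps(1))

text \<open>Up to equality on \<open>A\<close>, the generated class is stable under partial derivatives, so the
  condition on all iterated derivatives need only be checked one derivative at a time.\<close>

inductive smooth_gen :: "pt set \<Rightarrow> fn \<Rightarrow> bool" for A where
  base: "smooth_on A f \<Longrightarrow> smooth_gen A f"
| const: "smooth_gen A (\<lambda>p. c)"
| coord: "smooth_gen A (\<lambda>p. snd p $ k)"
| add: "smooth_gen A f \<Longrightarrow> smooth_gen A g \<Longrightarrow> smooth_gen A (\<lambda>p. f p + g p)"
| mult: "smooth_gen A f \<Longrightarrow> smooth_gen A g \<Longrightarrow> smooth_gen A (\<lambda>p. f p * g p)"
| inverse: "smooth_gen A f \<Longrightarrow> (\<And>p. p \<in> A \<Longrightarrow> f p \<noteq> 0) \<Longrightarrow> smooth_gen A (\<lambda>p. inverse (f p))"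
| exp: "smooth_gen A f \<Longrightarrow> smooth_gen A (\<lambda>p. exp (f p))"
| cong: "smooth_gen A f \<Longrightarrow> (\<And>p. p \<in> A \<Longrightarrow> g p = f p) \<Longrightarrow> smooth_gen A g"

lemma has_pd_coord:
  "((\<lambda>t. snd (p + t *\<^sub>R dirv b i) $ k) has_real_derivative (if b \<and> i = k then 1 else 0)) (at 0)"
  by (cases b) (auto simp: dirv_def axis_def intro!: derivative_eq_intros)

lemma smooth_gen_step:
  assumes "open A" "smooth_gen A f"
  shows "continuous_on A f \<and> (\<forall>b i. smooth_gen A (pd b i f) \<and>
    (\<forall>p\<in>A. ((\<lambda>t. f (p + t *\<^sub>R dirv b i)) has_real_derivative pd b i f p) (at 0)))"
  using assms(2)
proof induction
  case (base f)
  then show ?case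
    by (auto intro: smooth_gen.base smooth_on_pd smooth_on_has_pd smooth_on_imp_continuous_on)
next
  case (const c)
  have *: "((\<lambda>t. c) has_real_derivative 0) (at 0)" by simp
  have "pd b i (\<lambda>p. c) = (\<lambda>p. 0)" for b i
    by (rule ext, rule pd_eqI, rule *)
  then show ?case by (simp add: smooth_gen.const)
next
  case (coord k)
  have *: "pd b i (\<lambda>p. snd p $ k) = (\<lambda>p. if b \<and> i = k then 1 else 0)" for b i
    by (rule ext, rule pd_eqI, rule has_pd_coord)
  show ?case unfolding *
    by (intro conjI allI smooth_gen.const ballI has_pd_coord continuous_intros)
next
  case (add f g)
  have D: "((\<lambda>t. f (p + t *\<^sub>R dirv b i) + g (p + t *\<^sub>R dirv b i)) has_real_derivative
      pd b i f p + pd b i g p) (at 0)" if "p \<in> A" for p b i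
    using add.IH that by (auto intro!: derivative_eq_intros)
  have E: "pd b i (\<lambda>p. f p + g p) p = pd b i f p + pd b i g p" if "p \<in> A" for p b i
    by (rule pd_eqI, rule D[OF that])
  have "smooth_gen A (pd b i (\<lambda>p. f p + g p))" for b i
    by (rule smooth_gen.cong[OF smooth_gen.add[of A "pd b i f" "pd b i g"]]) (use add.IH E in auto)
  then show ?case using add.IH D E by (auto intro!: continuous_intros)
next
  case (mult f g)
  have D: "((\<lambda>t. f (p + t *\<^sub>R dirv b i) * g (p + t *\<^sub>R dirv b i)) has_real_derivative
      pd b i f p * g p + f p * pd b i g p) (at 0)" if "p \<in> A" for p b i
  proof -
    have "((\<lambda>t. f (p + t *\<^sub>R dirv b i)) has_real_derivative pd b i f p) (at 0)"
     "((\<lambda>t. g (p + t *\<^sub>R dirv b i)) has_real_derivative pd b i g p) (at 0)"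
      using mult.IH that by auto
    from DERIV_mult[OF this] show ?thesis by (simp add: algebra_simps)
  qed
  have E: "pd b i (\<lambda>p. f p * g p) p = pd b i f p * g p + f p * pd b i g p" if "p \<in> A" for p b i
    by (rule pd_eqI, rule D[OF that])
  have "smooth_gen A (pd b i (\<lambda>p. f p * g p))" for b i
    by (rule smooth_gen.cong[OF smooth_gen.add[OF smooth_gen.mult[of A "pd b i f" g]
          smooth_gen.mult[of A f "pd b i g"]]]) (use mult E in auto)
  then show ?case using mult.IH D E by (auto intro!: continuous_intros)
next
  case (inverse f)
  have D: "((\<lambda>t. inverse (f (p + t *\<^sub>R dirv b i))) has_real_derivative
      (- 1) * pd b i f p * (inverse (f p) * inverse (f p))) (at 0)" if "p \<in> A" for p b i
  proof -
    have "((\<lambda>t. f (p + t *\<^sub>R dirv b i)) has_real_derivative pd b i f p) (at 0)"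
      using inverse.IH that by auto
    from DERIV_inverse'[OF this] inverse.hyps(2)[OF that] show ?thesis by (simp add: algebra_simps)
  qed
  have E: "pd b i (\<lambda>p. inverse (f p)) p = (- 1) * pd b i f p * (inverse (f p) * inverse (f p))" if "p \<in> A" for p b i
    by (rule pd_eqI, rule D[OF that])
  have i: "smooth_gen A (\<lambda>p. inverse (f p))" using inverse.hyps by (rule smooth_gen.inverse)
  have "smooth_gen A (pd b i (\<lambda>p. inverse (f p)))" for b i
    by (rule smooth_gen.cong[OF smooth_gen.mult[OF smooth_gen.mult[OF smooth_gen.const[of A "-1"], of "pd b i f"]
          smooth_gen.mult[OF i i]]]) (use inverse.IH E in auto)
  then show ?case using inverse D E by (auto intro!: continuous_intros)
next
  case (exp f)
  have D: "((\<lambda>t. exp (f (p + t *\<^sub>R dirv b i))) has_real_derivative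
      exp (f p) * pd b i f p) (at 0)" if "p \<in> A" for p b i
  proof -
    have "((\<lambda>t. f (p + t *\<^sub>R dirv b i)) has_real_derivative pd b i f p) (at 0)"
      using exp.IH that by auto
    then show ?thesis by (auto intro!: derivative_eq_intros)
  qed
  have E: "pd b i (\<lambda>p. exp (f p)) p = exp (f p) * pd b i f p" if "p \<in> A" for p b i
    by (rule pd_eqI, rule D[OF that])
  have "smooth_gen A (pd b i (\<lambda>p. exp (f p)))" for b i
    by (rule smooth_gen.cong[OF smooth_gen.mult[OF smooth_gen.exp[OF exp.hyps], of "pd b i f"]]) (use exp.IH E in auto)
  then show ?case using exp.IH D E by (auto intro!: continuous_intros)
next
  case (cong f g)
  have E: "pd b i g p = pd b i f p" if "p \<in> A" for p b i
    using assms(1) that cong.hyps(2) by (rule pd_cong)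
  have D: "((\<lambda>t. g (p + t *\<^sub>R dirv b i)) has_real_derivative pd b i f p) (at 0)" if "p \<in> A" for p b i
  proof -
    have "eventually (\<lambda>t. g (p + t *\<^sub>R dirv b i) = f (p + t *\<^sub>R dirv b i)) (nhds 0)"
      using eventually_line_in_open[OF assms(1) that] by (rule eventually_mono) (rule cong.hyps(2))
    then show ?thesis using cong.IH that by (subst DERIV_cong_ev[OF refl _ refl]) auto
  qed
  have "smooth_gen A (pd b i g)" for b i
    by (rule smooth_gen.cong[of A "pd b i f"]) (use cong.IH E in auto)
  moreover have "continuous_on A g" using cong by (simp cong: continuous_on_cong)
  ultimately show ?case using D E by auto
qed

lemma smooth_gen_imp_smooth_on:
  assumes "open A" "smooth_gen A f"
  shows "smooth_on A f"
proof -
  have *: "smooth_gen A (iter_pd ds f)" for ds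
    by (induction ds) (use smooth_gen_step[OF assms(1)] assms(2) in auto)
  show ?thesis unfolding smooth_on_def real_differentiable_def
    using smooth_gen_step[OF assms(1) *] by blast
qed

lemma smooth_on_const: "open A \<Longrightarrow> smooth_on A (\<lambda>p. c)"
  by (intro smooth_gen_imp_smooth_on smooth_gen.const)

lemma smooth_on_coord: "open A \<Longrightarrow> smooth_on A (\<lambda>p. snd p $ k)"
  by (intro smooth_gen_imp_smooth_on smooth_gen.coord)

lemma smooth_on_add: "open A \<Longrightarrow> smooth_on A f \<Longrightarrow> smooth_on A g \<Longrightarrow> smooth_on A (\<lambda>p. f p + g p)"
  by (rule smooth_gen_imp_smooth_on, assumption, rule smooth_gen.add; rule smooth_gen.base)

lemma smooth_on_mult: "open A \<Longrightarrow> smooth_on A f \<Longrightarrow> smooth_on A g \<Longrightarrow> smooth_on A (\<lambda>p. f p * g p)"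
  by (rule smooth_gen_imp_smooth_on, assumption, rule smooth_gen.mult; rule smooth_gen.base)

lemma smooth_on_inverse:
  "open A \<Longrightarrow> smooth_on A f \<Longrightarrow> (\<And>p. p \<in> A \<Longrightarrow> f p \<noteq> 0) \<Longrightarrow> smooth_on A (\<lambda>p. inverse (f p))"
  by (rule smooth_gen_imp_smooth_on, assumption, rule smooth_gen.inverse, rule smooth_gen.base)

lemma smooth_on_exp: "open A \<Longrightarrow> smooth_on A f \<Longrightarrow> smooth_on A (\<lambda>p. exp (f p))"
  by (rule smooth_gen_imp_smooth_on, assumption, rule smooth_gen.exp; rule smooth_gen.base)

lemma smooth_on_cong:
  "open A \<Longrightarrow> smooth_on A f \<Longrightarrow> (\<And>p. p \<in> A \<Longrightarrow> g p = f p) \<Longrightarrow> smooth_on A g"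
  by (rule smooth_gen_imp_smooth_on, assumption, rule smooth_gen.cong, rule smooth_gen.base)

lemma smooth_on_minus: "open A \<Longrightarrow> smooth_on A f \<Longrightarrow> smooth_on A (\<lambda>p. - f p)"
  using smooth_on_mult[OF _ smooth_on_const[of A "-1"]] by simp

lemma smooth_on_diff: "open A \<Longrightarrow> smooth_on A f \<Longrightarrow> smooth_on A g \<Longrightarrow> smooth_on A (\<lambda>p. f p - g p)"
  using smooth_on_add[OF _ _ smooth_on_minus, of A f g] by simp

lemma smooth_on_divide: "open A \<Longrightarrow> smooth_on A f \<Longrightarrow> smooth_on A g \<Longrightarrow> (\<And>p. p \<in> A \<Longrightarrow> g p \<noteq> 0) \<Longrightarrow>
    smooth_on A (\<lambda>p. f p / g p)"
  using smooth_on_mult[OF _ _ smooth_on_inverse, of A f g] by (simp add: divide_inverse)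

lemma smooth_on_power: "open A \<Longrightarrow> smooth_on A f \<Longrightarrow> smooth_on A (\<lambda>p. f p ^ n)"
  by (induction n) (auto intro: smooth_on_const smooth_on_mult)

lemma smooth_on_sum: "open A \<Longrightarrow> (\<And>j. smooth_on A (f j)) \<Longrightarrow> smooth_on A (\<lambda>p. \<Sum>j\<in>S. f j p)"
  by (induction S rule: infinite_finite_induct) (auto intro: smooth_on_const smooth_on_add)

lemmas smooth_intros = smooth_on_const smooth_on_coord smooth_on_add smooth_on_mult smooth_on_exp
  smooth_on_minus smooth_on_diff smooth_on_divide smooth_on_power smooth_on_sum

lemma pd_const: "pd b i (\<lambda>p. c) p = 0"
  by (rule pd_eqI) simp

lemma pd_coord: "pd b i (\<lambda>p. snd p $ k) p = (if b \<and> i = k then 1 else 0)"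
  by (rule pd_eqI, rule has_pd_coord)

lemma pd_add:
  assumes "smooth_on A f" "smooth_on A g" "p \<in> A"
  shows "pd b i (\<lambda>p. f p + g p) p = pd b i f p + pd b i g p"
  by (rule pd_eqI, rule DERIV_add) (intro smooth_on_has_pd[OF _ assms(3)] assms)+

lemma pd_diff:
  assumes "smooth_on A f" "smooth_on A g" "p \<in> A"
  shows "pd b i (\<lambda>p. f p - g p) p = pd b i f p - pd b i g p"
  by (rule pd_eqI, rule DERIV_diff) (intro smooth_on_has_pd[OF _ assms(3)] assms)+

lemma pd_minus:
  assumes "smooth_on A f" "p \<in> A"
  shows "pd b i (\<lambda>p. - f p) p = - pd b i f p"
  by (rule pd_eqI, rule DERIV_minus) (intro smooth_on_has_pd[OF _ assms(2)] assms)+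

lemma pd_mult:
  assumes "smooth_on A f" "smooth_on A g" "p \<in> A"
  shows "pd b i (\<lambda>p. f p * g p) p = pd b i f p * g p + f p * pd b i g p"
proof (rule pd_eqI)
  show "((\<lambda>t. f (p + t *\<^sub>R dirv b i) * g (p + t *\<^sub>R dirv b i)) has_real_derivative
      pd b i f p * g p + f p * pd b i g p) (at 0)"
    using DERIV_mult[OF smooth_on_has_pd[OF assms(1,3), of b i] smooth_on_has_pd[OF assms(2,3), of b i]]
    by (simp add: algebra_simps)
qed

lemma pd_divide:
  assumes "smooth_on A f" "smooth_on A g" "p \<in> A" "g p \<noteq> 0"
  shows "pd b i (\<lambda>p. f p / g p) p = pd b i f p / g p - f p * pd b i g p / (g p)\<^sup>2"
proof (rule pd_eqI)
  show "((\<lambda>t. f (p + t *\<^sub>R dirv b i) / g (p + t *\<^sub>R dirv b i)) has_real_derivative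
      pd b i f p / g p - f p * pd b i g p / (g p)\<^sup>2) (at 0)"
    using DERIV_divide[OF smooth_on_has_pd[OF assms(1,3), of b i] smooth_on_has_pd[OF assms(2,3), of b i]] assms(4)
    by (simp add: field_simps power2_eq_square)
qed

lemma pd_exp:
  assumes "smooth_on A f" "p \<in> A"
  shows "pd b i (\<lambda>p. exp (f p)) p = exp (f p) * pd b i f p"
proof (rule pd_eqI)
  show "((\<lambda>t. exp (f (p + t *\<^sub>R dirv b i))) has_real_derivative exp (f p) * pd b i f p) (at 0)"
    using DERIV_fun_exp[OF smooth_on_has_pd[OF assms, of b i]] by simp
qed

lemma pd_sum:
  assumes "finite S" "\<And>j. j \<in> S \<Longrightarrow> smooth_on A (f j)" "p \<in> A"
  shows "pd b i (\<lambda>p. \<Sum>j\<in>S. f j p) p = (\<Sum>j\<in>S. pd b i (f j) p)"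
  by (rule pd_eqI, rule DERIV_sum) (intro smooth_on_has_pd[OF _ assms(3)] assms)

lemma box_in_open:
  fixes p u v :: "'a::real_normed_vector"
  assumes "open A" "p \<in> A"
  obtains r where "r > 0" "\<And>s t. \<bar>s\<bar> < r \<Longrightarrow> \<bar>t\<bar> < r \<Longrightarrow> p + s *\<^sub>R u + t *\<^sub>R v \<in> A"
proof -
  obtain e where e: "e > 0" "ball p e \<subseteq> A" using assms open_contains_ball by blast
  define r where "r = e / (norm u + norm v + 1)"
  have pos: "norm u + norm v + 1 > 0" by (simp add: add_nonneg_pos)
  have "r > 0" using e pos by (simp add: r_def)
  moreover have "p + s *\<^sub>R u + t *\<^sub>R v \<in> A" if "\<bar>s\<bar> < r" "\<bar>t\<bar> < r" for s t
  proof -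
    have "norm (s *\<^sub>R u + t *\<^sub>R v) \<le> \<bar>s\<bar> * norm u + \<bar>t\<bar> * norm v"
      using norm_triangle_ineq[of "s *\<^sub>R u" "t *\<^sub>R v"] by simp
    also have "\<dots> \<le> r * norm u + r * norm v"
      using that by (intro add_mono mult_right_mono) auto
    also have "\<dots> < r * (norm u + norm v + 1)" using \<open>r > 0\<close> by (simp add: algebra_simps)
    also have "\<dots> = e" using pos by (simp add: r_def)
    finally have "p + (s *\<^sub>R u + t *\<^sub>R v) \<in> ball p e"
      by (simp only: mem_ball dist_norm norm_minus_commute[of p]) simp
    then show ?thesis using e(2) by (auto simp: add.assoc)
  qed
  ultimately show ?thesis using that by blast
qed

lemma double_mean_value:
  fixes b c :: bool and i j :: 2
  defines "u \<equiv> dirv b i" and "v \<equiv> dirv c j"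
  assumes f: "smooth_on A f" and box: "\<And>s t. 0 \<le> s \<Longrightarrow> s \<le> h \<Longrightarrow> 0 \<le> t \<Longrightarrow> t \<le> h \<Longrightarrow>
      p + s *\<^sub>R u + t *\<^sub>R v \<in> A" and h: "h > 0"
  obtains s t where "0 < s" "s < h" "0 < t" "t < h"
    "f (p + h *\<^sub>R u + h *\<^sub>R v) - f (p + h *\<^sub>R u) - f (p + h *\<^sub>R v) + f p
      = h * (h * pd c j (pd b i f) (p + s *\<^sub>R u + t *\<^sub>R v))"
proof -
  have D1: "((\<lambda>s. f (p + h *\<^sub>R v + s *\<^sub>R u) - f (p + s *\<^sub>R u)) has_real_derivative
      (pd b i f (p + h *\<^sub>R v + s *\<^sub>R u) - pd b i f (p + s *\<^sub>R u))) (at s)" if "0 \<le> s" "s \<le> h" for s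
    unfolding u_def
  proof (intro DERIV_diff smooth_on_has_pd_shift[OF f])
    show "p + h *\<^sub>R v + s *\<^sub>R dirv b i \<in> A" using box[of s h] that h by (simp add: u_def algebra_simps)
    show "p + s *\<^sub>R dirv b i \<in> A" using box[of s 0] that h by (simp add: u_def algebra_simps)
  qed
  obtain s where s: "0 < s" "s < h" and es:
    "f (p + h *\<^sub>R v + h *\<^sub>R u) - f (p + h *\<^sub>R u) - (f (p + h *\<^sub>R v + 0 *\<^sub>R u) - f (p + 0 *\<^sub>R u))
      = (h - 0) * (pd b i f (p + h *\<^sub>R v + s *\<^sub>R u) - pd b i f (p + s *\<^sub>R u))"
    using MVT2[OF h D1] by blast
  have D2: "((\<lambda>t. pd b i f (p + s *\<^sub>R u + t *\<^sub>R v)) has_real_derivative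
      pd c j (pd b i f) (p + s *\<^sub>R u + t *\<^sub>R v)) (at t)" if "0 \<le> t" "t \<le> h" for t
    unfolding v_def using box[of s t] that s
    by (intro smooth_on_has_pd_shift[OF smooth_on_pd[OF f]]) (simp add: v_def)
  obtain t where t: "0 < t" "t < h" and et:
    "pd b i f (p + s *\<^sub>R u + h *\<^sub>R v) - pd b i f (p + s *\<^sub>R u + 0 *\<^sub>R v)
      = (h - 0) * pd c j (pd b i f) (p + s *\<^sub>R u + t *\<^sub>R v)"
    using MVT2[OF h D2] by blast
  show ?thesis
  proof (rule that[OF s t])
    show "f (p + h *\<^sub>R u + h *\<^sub>R v) - f (p + h *\<^sub>R u) - f (p + h *\<^sub>R v) + f p
      = h * (h * pd c j (pd b i f) (p + s *\<^sub>R u + t *\<^sub>R v))"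
      using es et by (simp add: ac_simps)
  qed
qed

lemma pd_commute:
  assumes A: "open A" and f: "smooth_on A f" and p: "p \<in> A"
  shows "pd b i (pd c j f) p = pd c j (pd b i f) p"
proof (rule ccontr)
  define g1 where "g1 = pd c j (pd b i f)"
  define g2 where "g2 = pd b i (pd c j f)"
  assume "pd b i (pd c j f) p \<noteq> pd c j (pd b i f) p"
  define e where "e = \<bar>g1 p - g2 p\<bar> / 2"
  have e: "e > 0" using \<open>_ \<noteq> _\<close> by (simp add: e_def g1_def g2_def)
  have cont: "continuous_on A g1" "continuous_on A g2"
    using f by (auto simp: g1_def g2_def intro: smooth_on_imp_continuous_on smooth_on_pd)
  define B where "B = (A \<inter> g1 -` ball (g1 p) e) \<inter> (A \<inter> g2 -` ball (g2 p) e)"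
  have "open B" unfolding B_def
    using cont A by (intro open_Int continuous_open_preimage open_ball)
  moreover have "p \<in> B" using p e by (simp add: B_def)
  ultimately obtain r where r: "r > 0"
    "\<And>s t. \<bar>s\<bar> < r \<Longrightarrow> \<bar>t\<bar> < r \<Longrightarrow> p + s *\<^sub>R dirv b i + t *\<^sub>R dirv c j \<in> B"
    by (rule box_in_open) blast
  define h where "h = r / 2"
  have h: "h > 0" "h < r" using r by (auto simp: h_def)
  obtain s t where st: "0 < s" "s < h" "0 < t" "t < h"
    "f (p + h *\<^sub>R dirv b i + h *\<^sub>R dirv c j) - f (p + h *\<^sub>R dirv b i) - f (p + h *\<^sub>R dirv c j) + f p
      = h * (h * g1 (p + s *\<^sub>R dirv b i + t *\<^sub>R dirv c j))"
    unfolding g1_def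
    by (rule double_mean_value[OF f _ h(1), of p b i c j]) (use r(2) h B_def in auto)
  obtain t' s' where ts: "0 < t'" "t' < h" "0 < s'" "s' < h"
    "f (p + h *\<^sub>R dirv c j + h *\<^sub>R dirv b i) - f (p + h *\<^sub>R dirv c j) - f (p + h *\<^sub>R dirv b i) + f p
      = h * (h * g2 (p + t' *\<^sub>R dirv c j + s' *\<^sub>R dirv b i))"
    unfolding g2_def
  proof (rule double_mean_value[OF f _ h(1), of p c j b i])
    fix t s assume "0 \<le> t" "t \<le> h" "0 \<le> s" "s \<le> h"
    then show "p + t *\<^sub>R dirv c j + s *\<^sub>R dirv b i \<in> A"
      using r(2)[of s t] h by (simp add: B_def algebra_simps)
  qed
  have "g1 (p + s *\<^sub>R dirv b i + t *\<^sub>R dirv c j) = g2 (p + s' *\<^sub>R dirv b i + t' *\<^sub>R dirv c j)"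
    using st(5) ts(5) h by (simp add: algebra_simps)
  moreover have "\<bar>g1 p - g1 (p + s *\<^sub>R dirv b i + t *\<^sub>R dirv c j)\<bar> < e"
    using r(2)[of s t] st h by (simp add: B_def dist_real_def)
  moreover have "\<bar>g2 p - g2 (p + s' *\<^sub>R dirv b i + t' *\<^sub>R dirv c j)\<bar> < e"
    using r(2)[of s' t'] ts h by (simp add: B_def dist_real_def)
  ultimately show False unfolding e_def by argo
qed

lemma vec2_eq_axis_sum: "(y :: real^2) = y$1 *\<^sub>R axis 1 1 + y$2 *\<^sub>R axis 2 1"
  by (simp add: vec_eq_iff forall_2 axis_def)

lemma DERIV_two_directions:
  fixes b c :: bool and i j :: 2
  defines "u \<equiv> dirv b i" and "v \<equiv> dirv c j"
  assumes A: "open A" and f: "smooth_on A f" and p: "p \<in> A"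
  shows "((\<lambda>t. f (p + (t * \<alpha>) *\<^sub>R u + (t * \<beta>) *\<^sub>R v)) has_real_derivative
      (\<alpha> * pd b i f p + \<beta> * pd c j f p)) (at 0)"
proof -
  obtain r where r: "r > 0" "\<And>s t. \<bar>s\<bar> < r \<Longrightarrow> \<bar>t\<bar> < r \<Longrightarrow> p + s *\<^sub>R u + t *\<^sub>R v \<in> A"
    by (rule box_in_open[OF A p]) blast
  define X where "X = {- r<..<r}"
  have X0: "0 \<in> X" "open X" "convex X" using r by (auto simp: X_def)
  have inA: "p + s *\<^sub>R u + t *\<^sub>R v \<in> A" if "s \<in> X" "t \<in> X" for s t
    using r(2)[of s t] that by (auto simp: X_def)
  have "((\<lambda>(s, t). f (p + s *\<^sub>R u + t *\<^sub>R v)) has_derivative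
      (\<lambda>(ts, tt). ts * pd b i f p + blinfun_apply (blinfun_scaleR_left (pd c j f (p + 0 *\<^sub>R u + 0 *\<^sub>R v))) tt))
      (at (0, 0) within X \<times> X)"
  proof (rule has_derivative_partialsI[where f="\<lambda>s t. f (p + s *\<^sub>R u + t *\<^sub>R v)"
        and fy="\<lambda>s t. blinfun_scaleR_left (pd c j f (p + s *\<^sub>R u + t *\<^sub>R v))"])
    show "((\<lambda>s. f (p + s *\<^sub>R u + 0 *\<^sub>R v)) has_derivative (\<lambda>ts. ts * pd b i f p)) (at 0 within X)"
      using smooth_on_has_pd[OF f p, of b i] unfolding u_def
      by (auto simp: has_field_derivative_def mult.commute[of _ "pd b i f p"] intro: has_derivative_at_withinI)
    show "((\<lambda>t. f (p + s *\<^sub>R u + t *\<^sub>R v)) has_derivative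
        blinfun_apply (blinfun_scaleR_left (pd c j f (p + s *\<^sub>R u + t *\<^sub>R v)))) (at t within X)"
      if "s \<in> X" "t \<in> X" for s t
    proof -
      have "((\<lambda>t. f (p + s *\<^sub>R u + t *\<^sub>R v)) has_real_derivative pd c j f (p + s *\<^sub>R u + t *\<^sub>R v)) (at t)"
        using inA[OF that] unfolding v_def by (rule smooth_on_has_pd_shift[OF f])
      moreover have "blinfun_apply (blinfun_scaleR_left (pd c j f (p + s *\<^sub>R u + t *\<^sub>R v)))
          = (*) (pd c j f (p + s *\<^sub>R u + t *\<^sub>R v))"
        by (auto simp: fun_eq_iff)
      ultimately show ?thesis
        by (simp add: has_field_derivative_def has_derivative_at_withinI)
    qed
    have *: "continuous_on (X \<times> X) (\<lambda>z. pd c j f (p + fst z *\<^sub>R u + snd z *\<^sub>R v))"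
      by (rule continuous_on_compose2[OF smooth_on_imp_continuous_on[OF smooth_on_pd[OF f]]])
         (auto intro!: continuous_intros inA)
    have "continuous_on (X \<times> X) (\<lambda>z. blinfun_scaleR_left (pd c j f (p + fst z *\<^sub>R u + snd z *\<^sub>R v)))"
      by (intro continuous_intros *)
    then show "continuous (at (0, 0) within X \<times> X) (\<lambda>(s, t). blinfun_scaleR_left (pd c j f (p + s *\<^sub>R u + t *\<^sub>R v)))"
      using X0 by (auto simp: continuous_on_eq_continuous_within case_prod_beta')
  qed (use X0 in auto)
  then have "((\<lambda>(s, t). f (p + s *\<^sub>R u + t *\<^sub>R v)) has_derivative
      (\<lambda>(ts, tt). ts * pd b i f p + tt * pd c j f p)) (at (0, 0))"
    using at_within_open[of "(0, 0)" "X \<times> X"] X0 by (simp add: open_Times case_prod_beta')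
  moreover have "((\<lambda>t. (t * \<alpha>, t * \<beta>)) has_derivative (\<lambda>h. (h * \<alpha>, h * \<beta>))) (at 0)"
    by (auto intro!: derivative_eq_intros)
  ultimately have "((\<lambda>(s, t). f (p + s *\<^sub>R u + t *\<^sub>R v)) \<circ> (\<lambda>t. (t * \<alpha>, t * \<beta>)) has_derivative
      (\<lambda>(ts, tt). ts * pd b i f p + tt * pd c j f p) \<circ> (\<lambda>h. (h * \<alpha>, h * \<beta>))) (at 0)"
    by (intro diff_chain_at) simp_all
  moreover have "(\<lambda>(ts, tt). ts * pd b i f p + tt * pd c j f p) \<circ> (\<lambda>h. (h * \<alpha>, h * \<beta>))
      = (*) (\<alpha> * pd b i f p + \<beta> * pd c j f p)"
    by (auto simp: fun_eq_iff algebra_simps)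
  ultimately show ?thesis
    by (simp add: has_field_derivative_def o_def)
qed

lemma homog_imp_Euler:
  assumes A: "conic_set A" and f: "smooth_on A f" and h: "homog A r f" and p: "p \<in> A"
  shows "sc1 f p = real r * f p"
proof -
  obtain x y where xy: "p = (x, y)" by (cases p)
  have oA: "open A" using A by (simp add: conic_set_def)
  have eq: "p + (t * y$1) *\<^sub>R dirv True 1 + (t * y$2) *\<^sub>R dirv True 2 = (x, (1 + t) *\<^sub>R y)" for t
    using vec2_eq_axis_sum[of "(1 + t) *\<^sub>R y"] vec2_eq_axis_sum[of y]
    by (simp add: xy dirv_def algebra_simps)
  have "((\<lambda>t. f (x, (1 + t) *\<^sub>R y)) has_real_derivative
      (y$1 * Dy 1 f p + y$2 * Dy 2 f p)) (at 0)"
    using DERIV_two_directions[OF oA f p, of "y$1" True 1 "y$2" True 2] unfolding eq .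
  moreover have "((\<lambda>t. f (x, (1 + t) *\<^sub>R y)) has_real_derivative (real r * f p)) (at 0)"
  proof -
    have ev: "eventually (\<lambda>t. f (x, (1 + t) *\<^sub>R y) = (1 + t) ^ r * f p) (nhds (0::real))"
    proof (rule eventually_mono)
      show "eventually (\<lambda>t::real. t \<in> {-1<..}) (nhds 0)" by (rule eventually_nhds_in_open) auto
      show "f (x, (1 + t) *\<^sub>R y) = (1 + t) ^ r * f p" if "t \<in> {-1<..}" for t
        using h p that unfolding homog_def xy by auto
    qed
    have "((\<lambda>t. (1 + t) ^ r * f p) has_real_derivative (real r * f p)) (at 0)"
      by (auto intro!: derivative_eq_intros)
    then show ?thesis by (subst DERIV_cong_ev[OF refl ev refl])
  qed
  ultimately show ?thesis
    using DERIV_unique by (fastforce simp: sc1_def sum_2 xy)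
qed

lemma indep_of_y_if_Dy_eq_0:
  assumes A: "open A" and f: "smooth_on A f" and D: "\<And>k p. p \<in> A \<Longrightarrow> Dy k f p = 0"
  shows "indep_of_y A f"
  unfolding indep_of_y_def
proof (intro allI impI)
  fix x y0 assume p: "(x, y0) \<in> A"
  obtain r where r: "r > 0" "\<And>s t. \<bar>s\<bar> < r \<Longrightarrow> \<bar>t\<bar> < r \<Longrightarrow>
      (x, y0) + s *\<^sub>R dirv True 1 + t *\<^sub>R dirv True 2 \<in> A"
    by (rule box_in_open[OF A p]) blast
  have line: "f (q + t *\<^sub>R dirv True k) = f q"
    if "\<bar>t\<bar> < r" and line_in: "\<And>t. \<bar>t\<bar> < r \<Longrightarrow> q + t *\<^sub>R dirv True k \<in> A" for q t k
  proof -
    have "((\<lambda>t. f (q + t *\<^sub>R dirv True k)) has_real_derivative 0) (at t within {-r<..<r})"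
      if "t \<in> {-r<..<r}" for t
    proof -
      have "q + t *\<^sub>R dirv True k \<in> A" using that by (intro line_in) auto
      from smooth_on_has_pd_shift[OF f this] D[OF this] show ?thesis
        by (simp add: has_field_derivative_at_within)
    qed
    then have "\<exists>c. \<forall>t\<in>{-r<..<r}. f (q + t *\<^sub>R dirv True k) = c"
      by (intro has_field_derivative_zero_constant convex_real_interval)
    then obtain c where c: "\<And>t. t \<in> {-r<..<r} \<Longrightarrow> f (q + t *\<^sub>R dirv True k) = c"
      by blast
    show ?thesis using c[of t] c[of 0] that(1) r(1) by (auto simp: abs_less_iff)
  qed
  have "f (x, y) = f (x, y0)" if "dist y y0 < r" for y
  proof -
    define s t where "s = y$1 - y0$1" and "t = y$2 - y0$2"
    have st: "\<bar>s\<bar> < r" "\<bar>t\<bar> < r"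
      using component_le_norm_cart[of "y - y0" 1] component_le_norm_cart[of "y - y0" 2] that
      by (auto simp: s_def t_def dist_norm)
    have "(x, y) = (x, y0) + s *\<^sub>R dirv True 1 + t *\<^sub>R dirv True 2"
      using vec2_eq_axis_sum[of y] vec2_eq_axis_sum[of y0] by (simp add: dirv_def s_def t_def algebra_simps)
    also have "f \<dots> = f ((x, y0) + s *\<^sub>R dirv True 1)"
      by (rule line[OF st(2)]) (use st r in simp)
    also have "\<dots> = f (x, y0)"
      by (rule line[OF st(1)]) (use r(1) r(2)[of _ 0] in simp)
    finally show ?thesis .
  qed
  then show "\<exists>e>0. \<forall>y. (x, y) \<in> A \<and> dist y y0 < e \<longrightarrow> f (x, y) = f (x, y0)"
    using r(1) by blast
qed

lemma open_slice:
  fixes A :: "('a::topological_space \<times> 'b::metric_space) set"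
  assumes "open A"
  shows "open {y. (x, y) \<in> A \<and> dist y y0 < e}"
proof -
  have "open (Pair x -` A)" using assms by (rule open_vimage) (intro continuous_intros)
  then have "open (Pair x -` A \<inter> ball y0 e)" by (intro open_Int open_ball)
  moreover have "{y. (x, y) \<in> A \<and> dist y y0 < e} = Pair x -` A \<inter> ball y0 e"
    by (auto simp: dist_commute)
  ultimately show ?thesis by simp
qed

lemma Dy_eq_0_if_indep_of_y:
  assumes A: "open A" and f: "indep_of_y A f" and p: "p \<in> A"
  shows "Dy k f p = 0"
proof -
  obtain x y where xy: "p = (x, y)" by (cases p)
  obtain e where e: "e > 0" "\<And>y'. (x, y') \<in> A \<Longrightarrow> dist y' y < e \<Longrightarrow> f (x, y') = f (x, y)"
    using f p unfolding indep_of_y_def xy by blast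
  have "Dy k f (x, y) = Dy k (\<lambda>_. f (x, y)) (x, y)"
  proof (rule Dy_cong_slice[OF open_slice[OF A, of x y e]])
    show "y \<in> {y'. (x, y') \<in> A \<and> dist y' y < e}" using e(1) p xy by simp
  qed (blast intro: e(2))
  then show ?thesis by (simp add: xy pd_const)
qed

lemma Dy_linear_form: "Dy i (\<lambda>p. \<Sum>k\<in>UNIV. a k * snd p $ k) = (\<lambda>p. a i)"
proof
  fix p
  have s: "smooth_on UNIV (\<lambda>p. a k * snd p $ k)" "smooth_on UNIV (\<lambda>p. a k)"
    "smooth_on UNIV (\<lambda>p. snd p $ k)" for k
    by (intro smooth_intros open_UNIV)+
  have "Dy i (\<lambda>p. a k * snd p $ k) p = (if i = k then a k else 0)" for k
    by (simp add: pd_mult[OF s(2,3)] pd_const pd_coord)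
  then show "Dy i (\<lambda>p. \<Sum>k\<in>UNIV. a k * snd p $ k) p = a i"
    by (simp add: pd_sum[OF _ s(1)])
qed

lemma Dy_quadratic_form:
  "Dy i (\<lambda>p. \<Sum>j\<in>UNIV. \<Sum>k\<in>UNIV. c j k * snd p $ j * snd p $ k)
    = (\<lambda>p. \<Sum>k\<in>UNIV. (c i k + c k i) * snd p $ k)"
proof
  fix p
  have s: "smooth_on UNIV (\<lambda>p. \<Sum>k\<in>UNIV. c j k * snd p $ j * snd p $ k)"
    "smooth_on UNIV (\<lambda>p. c j k * snd p $ j * snd p $ k)"
    "smooth_on UNIV (\<lambda>p. c j k * snd p $ j)" "smooth_on UNIV (\<lambda>p. c j k)"
    "smooth_on UNIV (\<lambda>p. snd p $ k)" for j k
    by (intro smooth_intros open_UNIV)+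
  have "Dy i (\<lambda>p. c j k * snd p $ j * snd p $ k) p
      = (if i = j then c j k * snd p $ k else 0) + (if i = k then c j k * snd p $ j else 0)" for j k
    by (simp add: pd_mult[OF s(3,5)] pd_mult[OF s(4,5)] pd_const pd_coord)
  then have "(\<Sum>j\<in>UNIV. \<Sum>k\<in>UNIV. Dy i (\<lambda>p. c j k * snd p $ j * snd p $ k) p)
      = (\<Sum>k\<in>UNIV. (c i k + c k i) * snd p $ k)"
    using exhaust_2[of i] by (simp only: sum_2) (auto simp: algebra_simps)
  moreover have "Dy i (\<lambda>p. \<Sum>j\<in>UNIV. \<Sum>k\<in>UNIV. c j k * snd p $ j * snd p $ k) p
      = (\<Sum>j\<in>UNIV. \<Sum>k\<in>UNIV. Dy i (\<lambda>p. c j k * snd p $ j * snd p $ k) p)"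
    by (simp only: pd_sum[OF finite s(1) UNIV_I] pd_sum[OF finite s(2) UNIV_I])
  ultimately show "Dy i (\<lambda>p. \<Sum>j\<in>UNIV. \<Sum>k\<in>UNIV. c j k * snd p $ j * snd p $ k) p
      = (\<Sum>k\<in>UNIV. (c i k + c k i) * snd p $ k)"
    by simp
qed

lemma Dy_Dy_quadratic_in_y:
  assumes A: "open A" and f: "quadratic_in_y A f"
  shows "indep_of_y A (Dy i (Dy j f))"
  unfolding indep_of_y_def
proof (intro allI impI)
  fix x y0 assume p: "(x, y0) \<in> A"
  obtain e c where e: "e > 0" "\<And>y. (x, y) \<in> A \<Longrightarrow> dist y y0 < e \<Longrightarrow>
      f (x, y) = (\<Sum>j\<in>UNIV. \<Sum>k\<in>UNIV. c j k * y$j * y$k)"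
    using f p unfolding quadratic_in_y_def by meson
  define q :: fn where "q = (\<lambda>p. \<Sum>j\<in>UNIV. \<Sum>k\<in>UNIV. c j k * snd p $ j * snd p $ k)"
  define U where "U = {y. (x, y) \<in> A \<and> dist y y0 < e}"
  have U: "open U" unfolding U_def by (rule open_slice[OF A])
  have 0: "f (x, y) = q (x, y)" if "y \<in> U" for y using that e(2) by (simp add: U_def q_def)
  have 1: "Dy j f (x, y) = Dy j q (x, y)" if "y \<in> U" for y
    using U that 0 by (rule Dy_cong_slice)
  have 2: "Dy i (Dy j f) (x, y) = Dy i (Dy j q) (x, y)" if "y \<in> U" for y
    using U that 1 by (rule Dy_cong_slice)
  have "Dy i (Dy j f) (x, y) = Dy i (Dy j f) (x, y0)" if "(x, y) \<in> A" "dist y y0 < e" for y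
    using 2[of y] 2[of y0] that p e(1)
    by (simp add: U_def q_def Dy_quadratic_form Dy_linear_form)
  then show "\<exists>e>0. \<forall>y. (x, y) \<in> A \<and> dist y y0 < e \<longrightarrow>
      Dy i (Dy j f) (x, y) = Dy i (Dy j f) (x, y0)"
    using e(1) by blast
qed

lemma quadratic_in_y_if_indep_coeffs:
  assumes c: "\<And>j k. indep_of_y A (c j k)"
    and f: "\<And>p. p \<in> A \<Longrightarrow> f p = (\<Sum>j\<in>UNIV. \<Sum>k\<in>UNIV. c j k p * snd p $ j * snd p $ k)"
  shows "quadratic_in_y A f"
  unfolding quadratic_in_y_def
proof (intro allI impI)
  fix x y0 assume p: "(x, y0) \<in> A"
  have "\<forall>j k. \<exists>e>0. \<forall>y. (x, y) \<in> A \<and> dist y y0 < e \<longrightarrow> c j k (x, y) = c j k (x, y0)"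
    using c p unfolding indep_of_y_def by blast
  then obtain e where e: "\<And>j k. e j k > 0"
    "\<And>j k y. (x, y) \<in> A \<Longrightarrow> dist y y0 < e j k \<Longrightarrow> c j k (x, y) = c j k (x, y0)"
    by metis
  define r where "r = Min (range (\<lambda>(j, k). e j k))"
  have r: "r > 0" "r \<le> e j k" for j k
    using e(1) by (auto simp: r_def intro!: Min_le)
  have "f (x, y) = (\<Sum>j\<in>UNIV. \<Sum>k\<in>UNIV. c j k (x, y0) * y$j * y$k)" if "(x, y) \<in> A" "dist y y0 < r" for y
  proof -
    have "c j k (x, y) = c j k (x, y0)" for j k
      using e(2)[OF that(1)] that(2) r(2) less_le_trans by blast
    then show ?thesis using f[OF that(1)] by simp
  qed
  then show "\<exists>e>0. \<exists>c. \<forall>y. (x, y) \<in> A \<and> dist y y0 < e \<longrightarrow>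
      f (x, y) = (\<Sum>j\<in>UNIV. \<Sum>k\<in>UNIV. c j k * y$j * y$k)"
    using r(1) by (intro exI[of _ r] conjI exI[of _ "\<lambda>j k. c j k (x, y0)"]) auto
qed

lemma quadratic_in_y_add_scaled:
  assumes "quadratic_in_y B f" "quadratic_in_y B h"
  shows "quadratic_in_y B (\<lambda>p. f p + x * h p)"
  unfolding quadratic_in_y_def
proof (intro allI impI)
  fix x0 y0 assume p: "(x0, y0) \<in> B"
  obtain e c e' c' where e: "e > 0" "\<And>y. (x0, y) \<in> B \<Longrightarrow> dist y y0 < e \<Longrightarrow>
      f (x0, y) = (\<Sum>j\<in>UNIV. \<Sum>k\<in>UNIV. c j k * y$j * y$k)"
   and e': "e' > 0" "\<And>y. (x0, y) \<in> B \<Longrightarrow> dist y y0 < e' \<Longrightarrow>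
      h (x0, y) = (\<Sum>j\<in>UNIV. \<Sum>k\<in>UNIV. c' j k * y$j * y$k)"
    using assms p unfolding quadratic_in_y_def by meson
  show "\<exists>e>0. \<exists>c. \<forall>y. (x0, y) \<in> B \<and> dist y y0 < e \<longrightarrow>
      f (x0, y) + x * h (x0, y) = (\<Sum>j\<in>UNIV. \<Sum>k\<in>UNIV. c j k * y$j * y$k)"
  proof (intro exI[of _ "min e e'"] conjI exI[of _ "\<lambda>j k. c j k + x * c' j k"] allI impI)
    fix y assume "(x0, y) \<in> B \<and> dist y y0 < min e e'"
    then show "f (x0, y) + x * h (x0, y) = (\<Sum>j\<in>UNIV. \<Sum>k\<in>UNIV. (c j k + x * c' j k) * y$j * y$k)"
      by (simp add: e(2) e'(2) sum_2 algebra_simps)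
  qed (use e(1) e'(1) in simp)
qed

lemma quadratic_in_y_cong:
  "quadratic_in_y B f \<Longrightarrow> (\<And>p. p \<in> B \<Longrightarrow> h p = f p) \<Longrightarrow> quadratic_in_y B h"
  unfolding quadratic_in_y_def by simp

lemma indep_of_y_cong:
  "indep_of_y B f \<Longrightarrow> (\<And>p. p \<in> B \<Longrightarrow> h p = f p) \<Longrightarrow> indep_of_y B h"
  unfolding indep_of_y_def by simp

section \<open>Euler's relation\<close>

definition Euler :: "pt set \<Rightarrow> real \<Rightarrow> fn \<Rightarrow> bool" where
  "Euler A r f \<longleftrightarrow> (\<forall>p\<in>A. sc1 f p = r * f p)"

locale open_domain =
  fixes A :: "pt set"
  assumes open_A [simp]: "open A"
begin

lemmas smooth_simps = smooth_intros[OF open_A] smooth_on_pd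
lemmas pd_simps = pd_const pd_coord pd_add[where A = A] pd_diff[where A = A] pd_minus[where A = A]
  pd_mult[where A = A] pd_divide[where A = A] pd_exp[where A = A]

lemma sc1_simps:
  assumes "smooth_on A f" "smooth_on A g" "p \<in> A"
  shows "sc1 (\<lambda>p. f p + g p) p = sc1 f p + sc1 g p"
    "sc1 (\<lambda>p. f p - g p) p = sc1 f p - sc1 g p"
    "sc1 (\<lambda>p. f p * g p) p = sc1 f p * g p + f p * sc1 g p"
    "g p \<noteq> 0 \<Longrightarrow> sc1 (\<lambda>p. f p / g p) p = sc1 f p / g p - f p * sc1 g p / (g p)\<^sup>2"
  using assms by (simp_all add: sc1_def sum_2 pd_simps algebra_simps add_divide_distrib)

lemma sc1_cong: "(\<And>p. p \<in> A \<Longrightarrow> f p = g p) \<Longrightarrow> p \<in> A \<Longrightarrow> sc1 f p = sc1 g p"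
  using pd_cong[OF open_A, of p f g] by (simp add: sc1_def)

lemma Euler_cong: "Euler A r f \<Longrightarrow> (\<And>p. p \<in> A \<Longrightarrow> g p = f p) \<Longrightarrow> Euler A r g"
  using sc1_cong[of g f] by (simp add: Euler_def)

lemma Euler_const: "Euler A 0 (\<lambda>p. c)"
  by (simp add: Euler_def sc1_def pd_const)

lemma Euler_coord: "Euler A 1 (\<lambda>p. snd p $ k)"
  using exhaust_2[of k] by (auto simp: Euler_def sc1_def pd_coord sum_2)

lemma Euler_add:
  "smooth_on A f \<Longrightarrow> smooth_on A g \<Longrightarrow> Euler A r f \<Longrightarrow> Euler A r g \<Longrightarrow> Euler A r (\<lambda>p. f p + g p)"
  by (simp add: Euler_def sc1_simps algebra_simps)

lemma Euler_diff:
  "smooth_on A f \<Longrightarrow> smooth_on A g \<Longrightarrow> Euler A r f \<Longrightarrow> Euler A r g \<Longrightarrow> Euler A r (\<lambda>p. f p - g p)"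
  by (simp add: Euler_def sc1_simps algebra_simps)

lemma Euler_mult:
  "smooth_on A f \<Longrightarrow> smooth_on A g \<Longrightarrow> Euler A r f \<Longrightarrow> Euler A s g \<Longrightarrow> t = r + s \<Longrightarrow>
    Euler A t (\<lambda>p. f p * g p)"
  by (simp add: Euler_def sc1_simps algebra_simps)

lemma Euler_divide:
  "smooth_on A f \<Longrightarrow> smooth_on A g \<Longrightarrow> (\<And>p. p \<in> A \<Longrightarrow> g p \<noteq> 0) \<Longrightarrow> Euler A r f \<Longrightarrow> Euler A s g \<Longrightarrow>
    t = r - s \<Longrightarrow> Euler A t (\<lambda>p. f p / g p)"
  by (simp add: Euler_def sc1_simps left_diff_distrib diff_divide_distrib power2_eq_square)

lemma Euler_Dx:
  assumes f: "smooth_on A f" and E: "Euler A r f"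
  shows "Euler A r (Dx i f)"
  unfolding Euler_def
proof
  fix p assume p: "p \<in> A"
  have "sc1 (Dx i f) p = (\<Sum>j\<in>UNIV. snd p $ j * Dx i (Dy j f) p)"
    by (simp add: sc1_def pd_commute[OF open_A f p])
  also have "\<dots> = Dx i (sc1 f) p"
    using f p by (simp add: sc1_def[abs_def] sum_2 pd_simps smooth_simps)
  also have "\<dots> = Dx i (\<lambda>p. r * f p) p"
    using E by (intro pd_cong[OF open_A p]) (simp add: Euler_def)
  also have "\<dots> = r * Dx i f p" using f p by (simp add: pd_simps smooth_simps)
  finally show "sc1 (Dx i f) p = r * Dx i f p" .
qed

lemma Euler_Dy:
  assumes f: "smooth_on A f" and E: "Euler A r f" and s: "s = r - 1"
  shows "Euler A s (Dy i f)"
  unfolding Euler_def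
proof
  fix p assume p: "p \<in> A"
  have "sc1 (Dy i f) p = (\<Sum>j\<in>UNIV. snd p $ j * Dy i (Dy j f) p)"
    by (simp add: sc1_def pd_commute[OF open_A f p])
  also have "\<dots> = Dy i (sc1 f) p - Dy i f p"
    using f p exhaust_2[of i] by (auto simp add: sc1_def[abs_def] sum_2 pd_simps smooth_simps)
  also have "Dy i (sc1 f) p = Dy i (\<lambda>p. r * f p) p"
    using E by (intro pd_cong[OF open_A p]) (simp add: Euler_def)
  also have "\<dots> = r * Dy i f p" using f p by (simp add: pd_simps smooth_simps)
  finally show "sc1 (Dy i f) p = s * Dy i f p" unfolding s by (simp add: left_diff_distrib)
qed

end

section \<open>The Berwald frame of a pseudo-Riemannian surface\<close>

lemma matrix_inv_mult_left:
  fixes M :: "'a::field^'n^'n"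
  assumes "det M \<noteq> 0"
  shows "matrix_inv M ** M = mat 1"
proof -
  have "\<exists>N. M ** N = mat 1 \<and> N ** M = mat 1"
    using assms invertible_det_nz[of M] by (simp add: invertible_def)
  then show ?thesis unfolding matrix_inv_def by (rule someI2_ex) blast
qed

lemma matrix_inv_2:
  fixes M :: "real^2^2"
  assumes "det M \<noteq> 0"
  shows "matrix_inv M $ 1 $ 1 = M $ 2 $ 2 / det M" "matrix_inv M $ 1 $ 2 = - M $ 1 $ 2 / det M"
    "matrix_inv M $ 2 $ 1 = - M $ 2 $ 1 / det M" "matrix_inv M $ 2 $ 2 = M $ 1 $ 1 / det M"
proof -
  define N :: "real^2^2" where "N = (\<chi> i j. (if i = 1 then if j = 1 then M $ 2 $ 2 else - M $ 1 $ 2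
     else if j = 1 then - M $ 2 $ 1 else M $ 1 $ 1) / det M)"
  have "M ** N = mat 1"
    using assms by (simp add: vec_eq_iff forall_2 matrix_matrix_mult_def sum_2 mat_def N_def
        divide_simps, simp add: det_2 algebra_simps)
  moreover have "matrix_inv M ** M = mat 1"
    using assms by (rule matrix_inv_mult_left)
  ultimately have "matrix_inv M = N"
    by (metis matrix_mul_assoc matrix_mul_lid matrix_mul_rid)
  then show "matrix_inv M $ 1 $ 1 = M $ 2 $ 2 / det M" "matrix_inv M $ 1 $ 2 = - M $ 1 $ 2 / det M"
    "matrix_inv M $ 2 $ 1 = - M $ 2 $ 1 / det M" "matrix_inv M $ 2 $ 2 = M $ 1 $ 1 / det M"
    by (auto simp: N_def)
qed

lemma ginv_mult_gmat:
  assumes "det (gmat F p) \<noteq> 0"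
  shows "(\<Sum>j\<in>UNIV. ginv F p $ i $ j * gmat F p $ j $ k) = (if i = k then 1 else 0)"
proof -
  have "ginv F p ** gmat F p = mat 1"
    using assms unfolding ginv_def by (rule matrix_inv_mult_left)
  then have "(ginv F p ** gmat F p) $ i $ k = (mat 1 :: real^2^2) $ i $ k" by simp
  then show ?thesis by (simp add: matrix_matrix_mult_def mat_def)
qed

locale riemannian_surface =
  fixes A :: "pt set" and F :: fn and eps :: real and m :: "2 \<Rightarrow> fn"
  assumes Finsler: "conic_pseudo_Finsler A F"
    and Riemannian: "quadratic_in_y A (sq F)"
    and frame: "berwald_frame A F eps m"

sublocale riemannian_surface \<subseteq> open_domain A
  using Finsler by unfold_locales (simp add: conic_pseudo_Finsler_def conic_set_def)

context riemannian_surface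
begin

abbreviation "l \<equiv> l_lo F"
abbreviation "lu \<equiv> l_up F"
abbreviation "mu \<equiv> m_up F m"
abbreviation "d \<equiv> sc2 F eps m"

definition g :: "2 \<Rightarrow> 2 \<Rightarrow> fn" where "g i j = (\<lambda>p. gmat F p $ i $ j)"
definition gi :: "2 \<Rightarrow> 2 \<Rightarrow> fn" where "gi i j = (\<lambda>p. ginv F p $ i $ j)"

lemma smooth_F [simp]: "smooth_on A F"
  and F_nz [simp]: "p \<in> A \<Longrightarrow> F p \<noteq> 0"
  and det_gmat_nz: "p \<in> A \<Longrightarrow> det (gmat F p) \<noteq> 0"
  using Finsler by (auto simp: conic_pseudo_Finsler_def)

lemma smooth_m [simp]: "smooth_on A (m i)"
  using frame by (auto simp: berwald_frame_def)

lemma eps_sq [simp]: "eps * eps = 1" "eps * (eps * x) = x" "eps\<^sup>2 = 1"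
  using frame by (auto simp: berwald_frame_def)

lemma eps_nz [simp]: "eps \<noteq> 0"
  using frame by (auto simp: berwald_frame_def)

lemma g_eq: "g i j = (\<lambda>p. 1/2 * Dy i (Dy j (sq F)) p)"
  by (simp add: g_def gmat_def)

lemma smooth_sq [simp]: "smooth_on A (sq F)"
  by (simp add: sq_def smooth_simps)

lemma smooth_g [simp]: "smooth_on A (g i j)"
  unfolding g_eq by (simp add: smooth_simps)

lemma smooth_l [simp]: "smooth_on A (l i)"
  by (simp add: l_lo_def smooth_simps)

lemma g_frame: "p \<in> A \<Longrightarrow> g i j p = l i p * l j p + eps * m i p * m j p"
  using frame by (simp add: berwald_frame_def g_def)

lemma Dy_F: "Dy i F p = l i p"
  by (simp add: l_lo_def)

lemma Dy_sq: "p \<in> A \<Longrightarrow> Dy i (sq F) p = 2 * F p * l i p"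
  by (simp add: sq_def power2_eq_square pd_simps Dy_F)

lemma Dy_l:
  assumes p: "p \<in> A"
  shows "Dy i (l j) p = eps * m i p * m j p / F p"
proof -
  have "Dy i (Dy j (sq F)) p = Dy i (\<lambda>p. 2 * F p * l j p) p"
    by (rule pd_cong[OF open_A p]) (rule Dy_sq)
  also have "\<dots> = 2 * (l i p * l j p + F p * Dy i (l j) p)"
    using p by (simp add: pd_simps smooth_simps Dy_F)
  finally show ?thesis
    using g_frame[OF p, of i j] p by (simp add: g_eq field_simps)
qed

lemma Dy_g: "p \<in> A \<Longrightarrow> Dy k (g i j) p = 0"
  unfolding g_eq
  using Dy_eq_0_if_indep_of_y[OF open_A Dy_Dy_quadratic_in_y[OF open_A Riemannian]]
  by (simp add: pd_simps smooth_simps)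

definition coframe_det :: fn where "coframe_det = (\<lambda>p. l 1 p * m 2 p - l 2 p * m 1 p)"

lemma det_gmat: "p \<in> A \<Longrightarrow> det (gmat F p) = eps * (coframe_det p)\<^sup>2"
  using g_frame[of p] unfolding g_def det_2 coframe_det_def
  by (simp add: power2_eq_square algebra_simps)

lemma coframe_det_nz [simp]: "p \<in> A \<Longrightarrow> coframe_det p \<noteq> 0"
  using det_gmat det_gmat_nz by fastforce

lemma m_not_all_0: "p \<in> A \<Longrightarrow> \<exists>i. m i p \<noteq> 0"
  using coframe_det_nz[of p] by (rule contrapos_pp) (simp_all add: coframe_det_def)

lemma Dy_m:
  assumes p: "p \<in> A"
  shows "Dy k (m i) p = - (m k p * l i p / F p)"
proof -
  have *: "(Dy k (m i) p + m k p * l i p / F p) * m j p + m i p * (Dy k (m j) p + m k p * l j p / F p) = 0" for i j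
  proof -
    have "Dy k (g i j) p = Dy k (\<lambda>p. l i p * l j p + eps * m i p * m j p) p"
      by (rule pd_cong[OF open_A p]) (rule g_frame)
    also have "\<dots> = eps * ((Dy k (m i) p + m k p * l i p / F p) * m j p + m i p * (Dy k (m j) p + m k p * l j p / F p))"
      using p by (simp add: pd_simps smooth_simps Dy_l field_simps)
    finally show ?thesis using Dy_g[OF p] by simp
  qed
  define w where "w i = Dy k (m i) p + m k p * l i p / F p" for i
  have w: "w i * m j p + m i p * w j = 0" for i j using * by (simp add: w_def)
  obtain i0 where i0: "m i0 p \<noteq> 0" using m_not_all_0[OF p] by blast
  have "w i0 = 0" using w[of i0 i0] i0 by simp
  then have "w i = 0" using w[of i i0] i0 by simp
  then show ?thesis by (simp add: w_def)
qed

lemma Euler_F [simp]: "Euler A 1 F"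
  using homog_imp_Euler[of A F 1] Finsler by (simp add: conic_pseudo_Finsler_def Euler_def)

lemma y_l: "p \<in> A \<Longrightarrow> snd p $ 1 * l 1 p + snd p $ 2 * l 2 p = F p"
  using Euler_F by (simp add: Euler_def sc1_def sum_2 Dy_F)

lemma Euler_l [simp]: "Euler A 0 (l i)"
  unfolding l_lo_def by (rule Euler_Dy[of F 1]) simp_all

lemma y_m:
  assumes p: "p \<in> A"
  shows "snd p $ 1 * m 1 p + snd p $ 2 * m 2 p = 0"
proof -
  obtain i where i: "m i p \<noteq> 0" using m_not_all_0[OF p] by blast
  have "0 = sc1 (l i) p" using Euler_l p by (simp add: Euler_def)
  also have "\<dots> = (snd p $ 1 * m 1 p + snd p $ 2 * m 2 p) * (eps * m i p / F p)"
    using p by (simp add: sc1_def sum_2 Dy_l field_simps)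
  finally show ?thesis using i p by simp
qed

lemma lu_l: "p \<in> A \<Longrightarrow> lu 1 p * l 1 p + lu 2 p * l 2 p = 1"
  using y_l[of p] by (simp add: l_up_def field_simps)

lemma lu_m: "p \<in> A \<Longrightarrow> lu 1 p * m 1 p + lu 2 p * m 2 p = 0"
  using y_m[of p] by (simp add: l_up_def field_simps)

lemma gi_g: "p \<in> A \<Longrightarrow> gi i 1 p * g 1 k p + gi i 2 p * g 2 k p = (if i = k then 1 else 0)"
  using ginv_mult_gmat[OF det_gmat_nz, of p i k] by (simp add: sum_2 g_def gi_def)

definition det_g :: fn where "det_g = (\<lambda>p. g 1 1 p * g 2 2 p - g 1 2 p * g 2 1 p)"

lemma gi_explicit:
  assumes "p \<in> A"
  shows "gi 1 1 p = g 2 2 p / det_g p" "gi 1 2 p = - g 1 2 p / det_g p"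
    "gi 2 1 p = - g 2 1 p / det_g p" "gi 2 2 p = g 1 1 p / det_g p"
  using matrix_inv_2[OF det_gmat_nz[OF assms]] by (simp_all add: gi_def g_def ginv_def det_2 det_g_def)

lemma det_g_nz [simp]: "p \<in> A \<Longrightarrow> det_g p \<noteq> 0"
  using det_gmat_nz[of p] by (simp add: g_def det_2 det_g_def)

lemma smooth_det_g [simp]: "smooth_on A det_g"
  by (simp add: det_g_def smooth_simps)

lemma Dy_det_g: "p \<in> A \<Longrightarrow> Dy k det_g p = 0"
  by (simp add: det_g_def pd_simps smooth_simps Dy_g)

lemma smooth_gi [simp]: "smooth_on A (gi i j)"
proof -
  have "smooth_on A (gi 1 1)"
    by (rule smooth_on_cong[OF open_A _ gi_explicit(1)]) (simp_all add: smooth_simps)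
  moreover have "smooth_on A (gi 1 2)"
    by (rule smooth_on_cong[OF open_A _ gi_explicit(2)]) (simp_all add: smooth_simps)
  moreover have "smooth_on A (gi 2 1)"
    by (rule smooth_on_cong[OF open_A _ gi_explicit(3)]) (simp_all add: smooth_simps)
  moreover have "smooth_on A (gi 2 2)"
    by (rule smooth_on_cong[OF open_A _ gi_explicit(4)]) (simp_all add: smooth_simps)
  ultimately show ?thesis using exhaust_2[of i] exhaust_2[of j] by auto
qed

lemma Dy_gi:
  assumes p: "p \<in> A"
  shows "Dy k (gi i j) p = 0"
proof -
  have "Dy k (gi 1 1) p = 0"
    by (subst pd_cong[OF open_A p gi_explicit(1)]) (simp_all add: p pd_simps smooth_simps Dy_det_g Dy_g)
  moreover have "Dy k (gi 1 2) p = 0"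
    by (subst pd_cong[OF open_A p gi_explicit(2)]) (simp_all add: p pd_simps smooth_simps Dy_det_g Dy_g)
  moreover have "Dy k (gi 2 1) p = 0"
    by (subst pd_cong[OF open_A p gi_explicit(3)]) (simp_all add: p pd_simps smooth_simps Dy_det_g Dy_g)
  moreover have "Dy k (gi 2 2) p = 0"
    by (subst pd_cong[OF open_A p gi_explicit(4)]) (simp_all add: p pd_simps smooth_simps Dy_det_g Dy_g)
  ultimately show ?thesis using exhaust_2[of i] exhaust_2[of j] by auto
qed

lemma g_sym: "p \<in> A \<Longrightarrow> g i j p = g j i p"
  by (simp add: g_frame)

lemma mu_eq: "mu i = (\<lambda>p. gi i 1 p * m 1 p + gi i 2 p * m 2 p)"
  by (simp add: m_up_def[abs_def] gi_def sum_2)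

lemma gi_l:
  assumes p: "p \<in> A"
  shows "gi i 1 p * l 1 p + gi i 2 p * l 2 p = lu i p"
proof -
  have l: "l j p = g j 1 p * lu 1 p + g j 2 p * lu 2 p" for j
  proof -
    have "g j 1 p * lu 1 p + g j 2 p * lu 2 p = l j p * (lu 1 p * l 1 p + lu 2 p * l 2 p)
        + eps * m j p * (lu 1 p * m 1 p + lu 2 p * m 2 p)"
      by (simp add: g_frame[OF p] algebra_simps)
    then show ?thesis using lu_l[OF p] lu_m[OF p] by simp
  qed
  have "gi i 1 p * l 1 p + gi i 2 p * l 2 p
     = (gi i 1 p * g 1 1 p + gi i 2 p * g 2 1 p) * lu 1 p + (gi i 1 p * g 1 2 p + gi i 2 p * g 2 2 p) * lu 2 p"
    by (simp add: l algebra_simps)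
  then show ?thesis using exhaust_2[of i] by (auto simp: gi_g[OF p])
qed

lemma frame_complete:
  assumes p: "p \<in> A"
  shows "lu i p * l k p + eps * mu i p * m k p = (if i = k then 1 else 0)"
  unfolding gi_l[OF p, symmetric] mu_eq
  using gi_g[OF p, of i k] by (simp add: g_frame[OF p] algebra_simps)

lemma frame_expansion:
  assumes p: "p \<in> A"
  shows "(lu 1 p * a 1 + lu 2 p * a 2) * l k p + eps * (mu 1 p * a 1 + mu 2 p * a 2) * m k p = a k"
proof -
  have "(lu 1 p * a 1 + lu 2 p * a 2) * l k p + eps * (mu 1 p * a 1 + mu 2 p * a 2) * m k p
     = (lu 1 p * l k p + eps * mu 1 p * m k p) * a 1 + (lu 2 p * l k p + eps * mu 2 p * m k p) * a 2"
    by (simp add: algebra_simps)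
  then show ?thesis using exhaust_2[of k] unfolding frame_complete[OF p] by auto
qed

lemma mu_l:
  assumes p: "p \<in> A"
  shows "mu 1 p * l 1 p + mu 2 p * l 2 p = 0"
proof -
  define X where "X = mu 1 p * l 1 p + mu 2 p * l 2 p"
  have "eps * X * m k p = 0" for k
    using frame_expansion[OF p, of "\<lambda>k. l k p" k] by (simp add: lu_l[OF p] X_def)
  then show ?thesis using m_not_all_0[OF p] by (auto simp: X_def)
qed

lemma mu_m:
  assumes p: "p \<in> A"
  shows "mu 1 p * m 1 p + mu 2 p * m 2 p = eps"
proof -
  define X where "X = mu 1 p * m 1 p + mu 2 p * m 2 p"
  have "eps * X * m k p = m k p" for k
    using frame_expansion[OF p, of "\<lambda>k. m k p" k] by (simp add: lu_m[OF p] X_def)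
  then have "eps * X = 1" using m_not_all_0[OF p] by auto
  then have "eps * (eps * X) = eps" by simp
  then show ?thesis by (simp add: X_def)
qed

lemma smooth_mu [simp]: "smooth_on A (mu i)"
  by (simp add: mu_eq smooth_simps)

lemma smooth_lu [simp]: "smooth_on A (lu i)"
  by (simp add: l_up_def[abs_def] smooth_simps)

lemma Dy_mu: "p \<in> A \<Longrightarrow> Dy k (mu i) p = - (m k p * lu i p / F p)"
  by (simp add: mu_eq pd_simps smooth_simps Dy_gi Dy_m gi_l[symmetric] field_simps)

lemma Dy_lu:
  assumes p: "p \<in> A"
  shows "Dy k (lu i) p = eps * mu i p * m k p / F p"
proof -
  have "Dy k (lu i) p = ((if i = k then 1 else 0) - lu i p * l k p) / F p"
    using p by (simp add: l_up_def[abs_def] pd_simps smooth_simps Dy_F field_simps power2_eq_square)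
  then show ?thesis by (simp add: frame_complete[OF p, symmetric])
qed

lemma Dy_decomp:
  assumes p: "p \<in> A"
  shows "Dy k f p = (sc1 f p * l k p + d f p * m k p) / F p"
proof -
  have "(sc1 f p * l k p + d f p * m k p) / F p
    = (lu 1 p * l k p + eps * mu 1 p * m k p) * Dy 1 f p + (lu 2 p * l k p + eps * mu 2 p * m k p) * Dy 2 f p"
    using p by (simp add: sc1_def sc2_def sum_2 l_up_def field_simps)
  then show ?thesis using exhaust_2[of k] unfolding frame_complete[OF p] by auto
qed

lemma d_eq: "d f = (\<lambda>p. eps * F p * (mu 1 p * Dy 1 f p + mu 2 p * Dy 2 f p))"
  by (simp add: sc2_def[abs_def] sum_2)

lemma smooth_d [simp]: "smooth_on A f \<Longrightarrow> smooth_on A (d f)"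
  by (simp add: d_eq smooth_simps)

lemma d_cong: "(\<And>p. p \<in> A \<Longrightarrow> f p = h p) \<Longrightarrow> p \<in> A \<Longrightarrow> d f p = d h p"
  using pd_cong[OF open_A, of p f h] by (simp add: d_eq)

lemma d_add: "smooth_on A f \<Longrightarrow> smooth_on A h \<Longrightarrow> p \<in> A \<Longrightarrow> d (\<lambda>p. f p + h p) p = d f p + d h p"
  and d_diff: "smooth_on A f \<Longrightarrow> smooth_on A h \<Longrightarrow> p \<in> A \<Longrightarrow> d (\<lambda>p. f p - h p) p = d f p - d h p"
  and d_mult: "smooth_on A f \<Longrightarrow> smooth_on A h \<Longrightarrow> p \<in> A \<Longrightarrow>
    d (\<lambda>p. f p * h p) p = d f p * h p + f p * d h p"
  and d_const: "d (\<lambda>p. c) p = 0"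
  by (simp_all add: d_eq pd_simps algebra_simps)

lemma d_F: "p \<in> A \<Longrightarrow> d F p = 0"
  using mu_l[of p] by (simp add: d_eq Dy_F)

lemma d_l:
  assumes p: "p \<in> A"
  shows "d (l j) p = eps * m j p"
proof -
  have "d (l j) p = (mu 1 p * m 1 p + mu 2 p * m 2 p) * m j p"
    using p by (simp add: d_eq Dy_l field_simps)
  then show ?thesis by (simp add: mu_m[OF p])
qed

lemma d_m:
  assumes p: "p \<in> A"
  shows "d (m j) p = - l j p"
proof -
  have "d (m j) p = - (eps * (mu 1 p * m 1 p + mu 2 p * m 2 p)) * l j p"
    using p by (simp add: d_eq Dy_m field_simps)
  then show ?thesis by (simp add: mu_m[OF p])
qed

lemma d_lu:
  assumes p: "p \<in> A"
  shows "d (lu i) p = eps * mu i p"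
proof -
  have "d (lu i) p = (mu 1 p * m 1 p + mu 2 p * m 2 p) * mu i p"
    using p by (simp add: d_eq Dy_lu field_simps)
  then show ?thesis by (simp add: mu_m[OF p])
qed

lemma d_mu:
  assumes p: "p \<in> A"
  shows "d (mu i) p = - lu i p"
proof -
  have "d (mu i) p = - (eps * (mu 1 p * m 1 p + mu 2 p * m 2 p)) * lu i p"
    using p by (simp add: d_eq Dy_mu field_simps)
  then show ?thesis by (simp add: mu_m[OF p])
qed

lemma Euler_lu [simp]: "Euler A 0 (lu i)"
  unfolding l_up_def[abs_def] by (rule Euler_divide[OF _ _ _ Euler_coord Euler_F]) (simp_all add: smooth_simps)

lemma Euler_mu [simp]: "Euler A 0 (mu i)"
  unfolding Euler_def
proof
  fix p assume p: "p \<in> A"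
  have "sc1 (mu i) p = - (snd p $ 1 * m 1 p + snd p $ 2 * m 2 p) * (lu i p / F p)"
    using p by (simp add: sc1_def sum_2 Dy_mu field_simps)
  then show "sc1 (mu i) p = 0 * mu i p" by (simp add: y_m[OF p])
qed

lemma Euler_d:
  assumes "smooth_on A f" "Euler A r f"
  shows "Euler A r (d f)"
proof -
  have "Euler A (r - 1) (\<lambda>p. mu i p * Dy i f p)" for i
    using assms by (intro Euler_mult[OF _ _ Euler_mu Euler_Dy]) (simp_all add: smooth_simps)
  then have "Euler A (r - 1) (\<lambda>p. mu 1 p * Dy 1 f p + mu 2 p * Dy 2 f p)"
    using assms by (intro Euler_add) (simp_all add: smooth_simps)
  moreover have "Euler A 1 (\<lambda>p. eps * F p)"
    by (rule Euler_mult[OF _ _ Euler_const Euler_F]) (simp_all add: smooth_simps)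
  ultimately show ?thesis unfolding d_eq using assms
    by (intro Euler_mult[of "\<lambda>p. eps * F p" _ 1 "r - 1"]) (simp_all add: smooth_simps)
qed

end

section \<open>The spray\<close>

lemma gmat_mult_ginv:
  assumes "det (gmat F p) \<noteq> 0"
  shows "(\<Sum>j\<in>UNIV. gmat F p $ i $ j * ginv F p $ j $ k) = (if i = k then 1 else 0)"
proof -
  have "ginv F p ** gmat F p = mat 1"
    using assms unfolding ginv_def by (rule matrix_inv_mult_left)
  then have "gmat F p ** ginv F p = mat 1" by (simp add: matrix_left_right_inverse)
  then have "(gmat F p ** ginv F p) $ i $ k = (mat 1 :: real^2^2) $ i $ k" by simp
  then show ?thesis by (simp add: matrix_matrix_mult_def mat_def)
qed

definition spray_lo :: "fn \<Rightarrow> 2 \<Rightarrow> fn" where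
  "spray_lo F i p = (\<Sum>k\<in>UNIV. snd p $ k * Dx k (Dy i (sq F)) p) - Dx i (sq F) p"

lemma spray_eq: "spray F i p = 1/4 * (ginv F p $ i $ 1 * spray_lo F 1 p + ginv F p $ i $ 2 * spray_lo F 2 p)"
  by (simp add: spray_def spray_lo_def sum_2)

lemma gmat_mult_spray:
  assumes "det (gmat F p) \<noteq> 0"
  shows "4 * (gmat F p $ i $ 1 * spray F 1 p + gmat F p $ i $ 2 * spray F 2 p) = spray_lo F i p"
proof -
  have "4 * (gmat F p $ i $ 1 * spray F 1 p + gmat F p $ i $ 2 * spray F 2 p)
     = (\<Sum>j\<in>UNIV. gmat F p $ i $ j * ginv F p $ j $ 1) * spray_lo F 1 p
     + (\<Sum>j\<in>UNIV. gmat F p $ i $ j * ginv F p $ j $ 2) * spray_lo F 2 p"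
    by (simp add: spray_eq sum_2 algebra_simps)
  then show ?thesis using exhaust_2[of i] unfolding gmat_mult_ginv[OF assms] by auto
qed

lemma spray_unique:
  assumes "det (gmat F p) \<noteq> 0"
    and "\<And>i. 4 * (gmat F p $ i $ 1 * X 1 + gmat F p $ i $ 2 * X 2) = spray_lo F i p"
  shows "spray F i p = X i"
proof -
  have "spray F i p = (\<Sum>j\<in>UNIV. ginv F p $ i $ j * gmat F p $ j $ 1) * X 1
     + (\<Sum>j\<in>UNIV. ginv F p $ i $ j * gmat F p $ j $ 2) * X 2"
    by (simp add: spray_eq assms(2)[symmetric] sum_2 algebra_simps)
  then show ?thesis using exhaust_2[of i] unfolding ginv_mult_gmat[OF assms(1)] by auto
qed

context riemannian_surface
begin

abbreviation "G \<equiv> spray F"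

lemma g_y:
  assumes "p \<in> A"
  shows "g i 1 p * snd p $ 1 + g i 2 p * snd p $ 2 = F p * l i p"
proof -
  have "g i 1 p * snd p $ 1 + g i 2 p * snd p $ 2 = l i p * (snd p $ 1 * l 1 p + snd p $ 2 * l 2 p)
      + eps * m i p * (snd p $ 1 * m 1 p + snd p $ 2 * m 2 p)"
    by (simp add: g_frame[OF assms] algebra_simps)
  then show ?thesis by (simp add: y_l y_m assms)
qed

lemma Dy_sq_g: "p \<in> A \<Longrightarrow> Dy i (sq F) p = 2 * (g i 1 p * snd p $ 1 + g i 2 p * snd p $ 2)"
  by (simp add: g_y Dy_sq)

lemma sq_g:
  assumes "p \<in> A"
  shows "sq F p = (g 1 1 p * snd p $ 1 + g 1 2 p * snd p $ 2) * snd p $ 1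
    + (g 2 1 p * snd p $ 1 + g 2 2 p * snd p $ 2) * snd p $ 2"
proof -
  have "F p * l 1 p * snd p $ 1 + F p * l 2 p * snd p $ 2 = F p * (snd p $ 1 * l 1 p + snd p $ 2 * l 2 p)"
    by (simp add: algebra_simps)
  then show ?thesis by (simp add: g_y assms y_l sq_def power2_eq_square)
qed

definition christoffel :: "2 \<Rightarrow> 2 \<Rightarrow> 2 \<Rightarrow> fn" where
  "christoffel i j k = (\<lambda>p. 1/4 * (gi i 1 p * (2 * Dx k (g 1 j) p - Dx 1 (g j k) p)
     + gi i 2 p * (2 * Dx k (g 2 j) p - Dx 2 (g j k) p)))"

lemma smooth_christoffel [simp]: "smooth_on A (christoffel i j k)"
  by (simp add: christoffel_def smooth_simps)

lemma Dy_Dx_g: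
  assumes p: "p \<in> A"
  shows "Dy n (Dx k (g i j)) p = 0"
proof -
  have "Dy n (Dx k (g i j)) p = Dx k (Dy n (g i j)) p"
    by (rule pd_commute[OF open_A smooth_g p])
  also have "\<dots> = Dx k (\<lambda>p. 0) p" by (rule pd_cong[OF open_A p]) (rule Dy_g)
  finally show ?thesis by (simp add: pd_const)
qed

lemma Dy_christoffel: "p \<in> A \<Longrightarrow> Dy n (christoffel i j k) p = 0"
  by (simp add: christoffel_def pd_simps smooth_simps Dy_gi Dy_Dx_g)

lemma G_christoffel:
  assumes p: "p \<in> A"
  shows "G i p = (\<Sum>j\<in>UNIV. \<Sum>k\<in>UNIV. christoffel i j k p * snd p $ j * snd p $ k)"
proof -
  have 1: "Dx k (Dy j (sq F)) p = 2 * (Dx k (g j 1) p * snd p $ 1 + Dx k (g j 2) p * snd p $ 2)" for j k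
    by (subst pd_cong[OF open_A p Dy_sq_g]) (simp_all add: pd_simps smooth_simps p)
  have 2: "Dx k (sq F) p = (Dx k (g 1 1) p * snd p $ 1 + Dx k (g 1 2) p * snd p $ 2) * snd p $ 1
    + (Dx k (g 2 1) p * snd p $ 1 + Dx k (g 2 2) p * snd p $ 2) * snd p $ 2" for k
    by (subst pd_cong[OF open_A p sq_g]) (simp_all add: pd_simps smooth_simps p)
  show ?thesis
    unfolding spray_eq spray_lo_def sum_2 1 2 christoffel_def gi_def by (simp add: algebra_simps)
qed

lemma smooth_G [simp]: "smooth_on A (G i)"
  by (rule smooth_on_cong[OF open_A _ G_christoffel]) (simp_all add: smooth_simps)

lemma quadratic_G: "quadratic_in_y A (G i)"
  by (rule quadratic_in_y_if_indep_coeffs[where c="christoffel i"])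
     (auto intro!: indep_of_y_if_Dy_eq_0 G_christoffel simp: Dy_christoffel)

lemma Euler_G: "Euler A 2 (G i)"
proof (rule Euler_cong[OF _ G_christoffel])
  have 0: "Euler A 0 (christoffel i j k)" for j k by (simp add: Euler_def sc1_def Dy_christoffel)
  have 1: "Euler A 1 (\<lambda>p. christoffel i j k p * snd p $ j)" for j k
    by (rule Euler_mult[OF _ _ 0 Euler_coord]) (simp_all add: smooth_simps)
  have 2: "Euler A 2 (\<lambda>p. christoffel i j k p * snd p $ j * snd p $ k)" for j k
    by (rule Euler_mult[OF _ _ 1 Euler_coord]) (simp_all add: smooth_simps)
  show "Euler A 2 (\<lambda>p. \<Sum>j\<in>UNIV. \<Sum>k\<in>UNIV. christoffel i j k p * snd p $ j * snd p $ k)"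
    unfolding sum_2 by (intro Euler_add 2) (simp_all add: smooth_simps)
qed

definition spray_field :: "fn \<Rightarrow> fn" where
  "spray_field f = (\<lambda>p. snd p $ 1 * Dx 1 f p + snd p $ 2 * Dx 2 f p - 2 * (G 1 p * Dy 1 f p + G 2 p * Dy 2 f p))"

lemma delta_eq: "delta F i f = (\<lambda>p. Dx i f p - (Dy i (G 1) p * Dy 1 f p + Dy i (G 2) p * Dy 2 f p))"
  by (simp add: delta_def[abs_def] sum_2 Gij_def)

lemma smooth_delta [simp]: "smooth_on A f \<Longrightarrow> smooth_on A (delta F i f)"
  by (simp add: delta_eq smooth_simps)

text \<open>The commutator \<open>[S, \<partial>/\<partial>y\<^sup>i] = - \<delta>\<^sub>i + G\<^sup>j\<^sub>i \<partial>/\<partial>y\<^sup>j\<close> of the spray with the vertical fields.\<close>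

lemma spray_commutator:
  assumes f: "smooth_on A f" and p: "p \<in> A"
  shows "snd p $ 1 * Dx 1 (Dy i f) p + snd p $ 2 * Dx 2 (Dy i f) p - Dx i f p =
    2 * (G 1 p * Dy i (Dy 1 f) p + G 2 p * Dy i (Dy 2 f) p) + Dy i (spray_field f) p - 2 * delta F i f p"
proof -
  have "Dy i (spray_field f) p = Dx i f p + (snd p $ 1 * Dy i (Dx 1 f) p + snd p $ 2 * Dy i (Dx 2 f) p)
     - 2 * (Dy i (G 1) p * Dy 1 f p + G 1 p * Dy i (Dy 1 f) p + Dy i (G 2) p * Dy 2 f p + G 2 p * Dy i (Dy 2 f) p)"
    using f p exhaust_2[of i] by (auto simp: spray_field_def pd_simps smooth_simps algebra_simps)
  then show ?thesis
    by (simp add: pd_commute[OF open_A f p, of True i False] delta_eq algebra_simps)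
qed

lemma spray_field_sq:
  assumes p: "p \<in> A"
  shows "spray_field (sq F) p = 0"
proof -
  have E: "Euler A 2 (sq F)"
    unfolding sq_def power2_eq_square by (rule Euler_mult[OF _ _ Euler_F Euler_F]) simp_all
  have sx: "snd p $ 1 * Dx k (Dy 1 (sq F)) p + snd p $ 2 * Dx k (Dy 2 (sq F)) p = 2 * Dx k (sq F) p" for k
  proof -
    have "sc1 (Dx k (sq F)) p = 2 * Dx k (sq F) p"
      using Euler_Dx[OF smooth_sq E, of k] p by (simp add: Euler_def)
    then show ?thesis
      by (simp add: sc1_def sum_2 pd_commute[OF open_A smooth_sq p, of True _ False])
  qed
  have e: "4 * (g i 1 p * G 1 p + g i 2 p * G 2 p) = snd p $ 1 * Dx 1 (Dy i (sq F)) p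
      + snd p $ 2 * Dx 2 (Dy i (sq F)) p - Dx i (sq F) p" for i
    using gmat_mult_spray[OF det_gmat_nz[OF p], of i] by (simp add: g_def spray_lo_def sum_2)
  have "2 * (G 1 p * Dy 1 (sq F) p + G 2 p * Dy 2 (sq F) p)
     = snd p $ 1 * (4 * (g 1 1 p * G 1 p + g 1 2 p * G 2 p)) + snd p $ 2 * (4 * (g 2 1 p * G 1 p + g 2 2 p * G 2 p))"
    by (simp add: Dy_sq_g p g_sym[OF p, of 2 1] algebra_simps)
  also have "\<dots> = snd p $ 1 * (snd p $ 1 * Dx 1 (Dy 1 (sq F)) p + snd p $ 2 * Dx 1 (Dy 2 (sq F)) p)
    + snd p $ 2 * (snd p $ 1 * Dx 2 (Dy 1 (sq F)) p + snd p $ 2 * Dx 2 (Dy 2 (sq F)) p)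
    - (snd p $ 1 * Dx 1 (sq F) p + snd p $ 2 * Dx 2 (sq F) p)"
    unfolding e by (simp add: algebra_simps)
  also have "\<dots> = snd p $ 1 * Dx 1 (sq F) p + snd p $ 2 * Dx 2 (sq F) p"
    unfolding sx by simp
  finally show ?thesis by (simp add: spray_field_def)
qed

lemma delta_sq:
  assumes p: "p \<in> A"
  shows "delta F i (sq F) p = 0"
proof -
  have "Dy i (spray_field (sq F)) p = Dy i (\<lambda>p. 0) p" by (rule pd_cong[OF open_A p]) (rule spray_field_sq)
  then have "Dy i (spray_field (sq F)) p = 0" by (simp add: pd_const)
  moreover have "4 * (g i 1 p * G 1 p + g i 2 p * G 2 p) = snd p $ 1 * Dx 1 (Dy i (sq F)) p
      + snd p $ 2 * Dx 2 (Dy i (sq F)) p - Dx i (sq F) p"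
    using gmat_mult_spray[OF det_gmat_nz[OF p], of i] by (simp add: g_def spray_lo_def sum_2)
  ultimately show ?thesis
    using spray_commutator[OF smooth_sq p, of i] by (simp add: g_eq algebra_simps)
qed

lemma y_delta:
  assumes p: "p \<in> A"
  shows "snd p $ 1 * delta F 1 f p + snd p $ 2 * delta F 2 f p = spray_field f p"
proof -
  have "snd p $ 1 * Dy 1 (G i) p + snd p $ 2 * Dy 2 (G i) p = 2 * G i p" for i
    using Euler_G p by (simp add: Euler_def sc1_def sum_2)
  then have "spray_field f p = snd p $ 1 * Dx 1 f p + snd p $ 2 * Dx 2 f p
     - ((snd p $ 1 * Dy 1 (G 1) p + snd p $ 2 * Dy 2 (G 1) p) * Dy 1 f p
      + (snd p $ 1 * Dy 1 (G 2) p + snd p $ 2 * Dy 2 (G 2) p) * Dy 2 f p)"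
    by (simp add: spray_field_def)
  then show ?thesis by (simp add: delta_eq algebra_simps)
qed

lemma cm1_spray_field: "p \<in> A \<Longrightarrow> cm1 F f p = spray_field f p / F p"
  by (simp add: y_delta[symmetric] cm1_def sum_2 l_up_def add_divide_distrib)

lemma delta_decomp:
  assumes p: "p \<in> A"
  shows "delta F i f p = cm1 F f p * l i p + cm2 F eps m f p * m i p"
  using frame_expansion[OF p, of "\<lambda>i. delta F i f p" i] by (simp add: cm1_def cm2_def sum_2)

lemma cm1_eq: "cm1 F f = (\<lambda>p. lu 1 p * delta F 1 f p + lu 2 p * delta F 2 f p)"
  by (simp add: cm1_def[abs_def] sum_2)

lemma cm2_eq: "cm2 F eps m f = (\<lambda>p. eps * (mu 1 p * delta F 1 f p + mu 2 p * delta F 2 f p))"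
  by (simp add: cm2_def[abs_def] sum_2)

lemma smooth_cm [simp]:
  assumes "smooth_on A f"
  shows "smooth_on A (cm1 F f)" "smooth_on A (cm2 F eps m f)"
  using assms by (simp_all add: cm1_eq cm2_eq smooth_simps)

lemma Euler_delta:
  assumes f: "smooth_on A f" "Euler A r f"
  shows "Euler A r (delta F i f)"
proof -
  have "Euler A r (\<lambda>p. Dy i (G j) p * Dy j f p)" for j
    by (rule Euler_mult[OF _ _ Euler_Dy[OF _ Euler_G refl] Euler_Dy[OF f refl]]) (use f in \<open>simp_all add: smooth_simps\<close>)
  then show ?thesis unfolding delta_eq
    by (intro Euler_diff Euler_add Euler_Dx) (use f in \<open>simp_all add: smooth_simps\<close>)
qed

lemma Euler_cm:
  assumes f: "smooth_on A f" "Euler A r f"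
  shows "Euler A r (cm1 F f)" "Euler A r (cm2 F eps m f)"
proof -
  have 1: "Euler A r (\<lambda>p. lu i p * delta F i f p)" "Euler A r (\<lambda>p. mu i p * delta F i f p)" for i
    by (rule Euler_mult[OF _ _ _ Euler_delta[OF f], where r=0]; use f in \<open>simp add: smooth_simps\<close>)+
  show "Euler A r (cm1 F f)" unfolding cm1_eq
    by (intro Euler_add 1) (use f in \<open>simp_all add: smooth_simps\<close>)
  have "Euler A r (\<lambda>p. mu 1 p * delta F 1 f p + mu 2 p * delta F 2 f p)"
    by (intro Euler_add 1) (use f in \<open>simp_all add: smooth_simps\<close>)
  then show "Euler A r (cm2 F eps m f)" unfolding cm2_eq
    by (intro Euler_mult[OF _ _ Euler_const, where s=r]) (use f in \<open>simp_all add: smooth_simps\<close>)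
qed

lemma main_scalar_eq_0:
  assumes p: "p \<in> A"
  shows "main_scalar F eps m p = 0"
proof -
  have "cartan F i j k p = 0" for i j k
    using Dy_g[OF p, of i j k] p by (simp add: cartan_def g_eq pd_simps smooth_simps)
  then show ?thesis by (simp add: main_scalar_def)
qed

end

section \<open>Anisotropic conformal changes\<close>

locale conformal_change = riemannian_surface +
  fixes phi :: fn
  assumes conf: "conf_admissible A F eps m phi"
begin

definition "Fb = (\<lambda>p. exp (phi p) * F p)"
abbreviation "P \<equiv> Pc F eps m phi"
abbreviation "Q \<equiv> Qc F eps m phi"
abbreviation "W \<equiv> Wc F eps m phi"
definition "a = d phi"
abbreviation "b \<equiv> cm1 F phi"
abbreviation "c \<equiv> cm2 F eps m phi"
definition "E = (\<lambda>p. exp (2 * phi p))"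

lemma smooth_phi [simp]: "smooth_on A phi"
  using conf by (simp add: conf_admissible_def)

lemma Euler_phi [simp]: "Euler A 0 phi"
  using homog_imp_Euler[of A phi 0] conf Finsler
  by (simp add: conf_admissible_def conic_pseudo_Finsler_def Euler_def)

lemma smooth_a [simp]: "smooth_on A a"
  and Euler_a [simp]: "Euler A 0 a"
  by (simp_all add: a_def Euler_d)

lemma smooth_E [simp]: "smooth_on A E"
  by (simp add: E_def smooth_simps)

lemma E_nz [simp]: "E p \<noteq> 0"
  by (simp add: E_def)

lemma pd_E: "p \<in> A \<Longrightarrow> pd x i E p = 2 * E p * pd x i phi p"
  by (simp add: E_def pd_simps smooth_simps)

lemma Dy_Euler_0: "Euler A 0 f \<Longrightarrow> p \<in> A \<Longrightarrow> Dy i f p = d f p * m i p / F p"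
  by (simp add: Dy_decomp Euler_def)

lemma Dy_phi: "p \<in> A \<Longrightarrow> Dy i phi p = a p * m i p / F p"
  by (simp add: Dy_Euler_0 a_def)

lemma Dy_a: "p \<in> A \<Longrightarrow> Dy i a p = d a p * m i p / F p"
  by (simp add: Dy_Euler_0)

lemma sq_Fb: "sq Fb = (\<lambda>p. E p * sq F p)"
  by (simp add: sq_def Fb_def E_def power_mult_distrib exp_double)

lemma Dy_sq_Fb: "p \<in> A \<Longrightarrow> Dy i (sq Fb) p = 2 * E p * F p * (a p * m i p + l i p)"
  by (simp add: sq_Fb pd_simps smooth_simps pd_E Dy_phi Dy_sq, simp add: sq_def power2_eq_square algebra_simps)

lemma gmat_Fb:
  assumes p: "p \<in> A"
  shows "gmat Fb p $ i $ j = E p * (l i p * l j p + a p * (l i p * m j p + m i p * l j p)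
    + (d a p + 2 * (a p)\<^sup>2 + eps) * m i p * m j p)"
proof -
  have "Dy i (Dy j (sq Fb)) p = Dy i (\<lambda>p. 2 * E p * F p * (a p * m j p + l j p)) p"
    by (rule pd_cong[OF open_A p]) (rule Dy_sq_Fb)
  also have "\<dots> = 2 * E p * (l i p * l j p + a p * (l i p * m j p + m i p * l j p)
    + (d a p + 2 * (a p)\<^sup>2 + eps) * m i p * m j p)"
    using p by (simp add: pd_simps smooth_simps pd_E Dy_F Dy_phi Dy_a Dy_l Dy_m field_simps power2_eq_square)
  finally show ?thesis by (simp add: gmat_def)
qed

lemma Dy_Dy_phi:
  assumes p: "p \<in> A"
  shows "Dy i (Dy j phi) p = (d a p * m i p * m j p - a p * (m i p * l j p + l i p * m j p)) / (F p)\<^sup>2"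
proof -
  have "Dy i (Dy j phi) p = Dy i (\<lambda>p. a p * m j p / F p) p"
    by (rule pd_cong[OF open_A p]) (rule Dy_phi)
  also have "\<dots> = (d a p * m i p * m j p - a p * (m i p * l j p + l i p * m j p)) / (F p)\<^sup>2"
    using p by (simp add: pd_simps smooth_simps Dy_F Dy_a Dy_m field_simps power2_eq_square)
  finally show ?thesis .
qed

definition "D = (\<lambda>p. d a p + (a p)\<^sup>2 + eps)"

lemma D_nz [simp]:
  assumes p: "p \<in> A"
  shows "D p \<noteq> 0"
proof -
  define X where "X i j = (Dy i (Dy j phi) p + Dy i phi p * Dy j phi p) * mu i p * mu j p" for i j
  have Xe: "X i j = (d a p + (a p)\<^sup>2) / (F p)\<^sup>2 * ((m i p * mu i p) * (m j p * mu j p))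
     - a p / (F p)\<^sup>2 * ((m i p * mu i p) * (l j p * mu j p) + (l i p * mu i p) * (m j p * mu j p))" for i j
    using p by (simp add: X_def Dy_Dy_phi Dy_phi field_simps power2_eq_square)
  have "X 1 1 + X 1 2 + (X 2 1 + X 2 2) = (d a p + (a p)\<^sup>2) / (F p)\<^sup>2 * (mu 1 p * m 1 p + mu 2 p * m 2 p)\<^sup>2
     - 2 * a p / (F p)\<^sup>2 * ((mu 1 p * m 1 p + mu 2 p * m 2 p) * (mu 1 p * l 1 p + mu 2 p * l 2 p))"
    unfolding Xe by algebra
  then have "(F p)\<^sup>2 * (X 1 1 + X 1 2 + (X 2 1 + X 2 2)) + eps = D p"
    using p by (simp add: mu_m mu_l D_def)
  moreover have "(F p)\<^sup>2 * (X 1 1 + X 1 2 + (X 2 1 + X 2 2)) + eps \<noteq> 0"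
    using conf p by (simp add: conf_admissible_def X_def sum_2)
  ultimately show ?thesis by simp
qed

lemma smooth_D [simp]: "smooth_on A D"
  by (simp add: D_def smooth_simps)

lemma rho_eq: "p \<in> A \<Longrightarrow> rho_c F eps m phi p = 1 / D p"
  by (simp add: rho_c_def sigma_c_def main_scalar_eq_0 D_def a_def)

lemma det_gmat_Fb:
  assumes p: "p \<in> A"
  shows "det (gmat Fb p) \<noteq> 0"
proof -
  have "det (gmat Fb p) = (E p)\<^sup>2 * (coframe_det p)\<^sup>2 * D p"
    unfolding det_2 gmat_Fb[OF p] by (simp add: coframe_det_def D_def power2_eq_square algebra_simps)
  then show ?thesis using p by simp
qed

lemma smooth_W [simp]: "smooth_on A W"
  by (simp add: Wc_def[abs_def] smooth_simps)

lemma Euler_W: "Euler A 0 W"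
proof -
  have "Euler A 0 (\<lambda>p. d phi p * b p)"
    by (rule Euler_mult[OF _ _ Euler_d Euler_cm(1), of phi phi 0 0]) simp_all
  moreover have "Euler A 0 (d b)" by (intro Euler_d Euler_cm) simp_all
  moreover have "Euler A 0 (\<lambda>p. 2 * c p)"
    by (rule Euler_mult[OF _ _ Euler_const Euler_cm(2), of _ phi 0]) (simp_all add: smooth_simps)
  ultimately show ?thesis unfolding Wc_def[abs_def]
    by (intro Euler_diff Euler_add) (simp_all add: smooth_simps)
qed

lemma Q_eq: "p \<in> A \<Longrightarrow> Q p = eps / 2 * (F p * F p) * (W p / D p)"
  by (simp add: Qc_def rho_eq power2_eq_square)

lemma P_eq: "p \<in> A \<Longrightarrow> P p = 1/2 * (F p * F p) * (b p - a p * (W p / D p))"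
  by (simp add: Pc_def rho_eq power2_eq_square a_def field_simps)

lemma Euler_D: "Euler A 0 D"
proof -
  have "Euler A 0 (\<lambda>p. a p * a p)" by (rule Euler_mult[OF _ _ Euler_a Euler_a]) simp_all
  then show ?thesis unfolding D_def power2_eq_square
    by (intro Euler_add Euler_d Euler_const) (simp_all add: smooth_simps)
qed

lemma Euler_cFF: "Euler A 2 (\<lambda>p. x * (F p * F p))"
proof -
  have "Euler A 2 (\<lambda>p. F p * F p)" by (rule Euler_mult[OF _ _ Euler_F Euler_F]) simp_all
  from Euler_mult[OF _ _ Euler_const this] show ?thesis by (simp add: smooth_simps)
qed

lemma Euler_WD: "Euler A 0 (\<lambda>p. W p / D p)"
  by (rule Euler_divide[OF _ _ _ Euler_W Euler_D]) simp_all

lemma smooth_Q [simp]: "smooth_on A Q"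
  by (rule smooth_on_cong[OF open_A _ Q_eq]) (simp_all add: smooth_simps)

lemma smooth_P [simp]: "smooth_on A P"
  by (rule smooth_on_cong[OF open_A _ P_eq]) (simp_all add: smooth_simps)

lemma Euler_Q: "Euler A 2 Q"
  by (rule Euler_cong[OF Euler_mult[OF _ _ Euler_cFF Euler_WD] Q_eq]) (simp_all add: smooth_simps)

lemma Euler_P: "Euler A 2 P"
proof -
  have "Euler A 0 (\<lambda>p. a p * (W p / D p))"
    by (rule Euler_mult[OF _ _ Euler_a Euler_WD]) (simp_all add: smooth_simps)
  then have "Euler A 0 (\<lambda>p. b p - a p * (W p / D p))"
    by (intro Euler_diff Euler_cm) (simp_all add: smooth_simps)
  then show ?thesis
    by (intro Euler_cong[OF Euler_mult[OF _ _ Euler_cFF] P_eq]) (simp_all add: smooth_simps)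
qed

definition V :: "2 \<Rightarrow> fn" where "V i = (\<lambda>p. P p * lu i p + Q p * mu i p)"

lemma smooth_V [simp]: "smooth_on A (V i)"
  by (simp add: V_def smooth_simps)

lemma Euler_V: "Euler A 2 (V i)"
proof -
  have "Euler A 2 (\<lambda>p. P p * lu i p)" "Euler A 2 (\<lambda>p. Q p * mu i p)"
    by (rule Euler_mult[OF _ _ Euler_P Euler_lu] Euler_mult[OF _ _ Euler_Q Euler_mu]; simp)+
  then show ?thesis unfolding V_def by (intro Euler_add) (simp_all add: smooth_simps)
qed

lemma sq_apply: "sq F p = F p * F p"
  by (simp add: sq_def power2_eq_square)

lemma spray_field_sq_Fb:
  assumes p: "p \<in> A"
  shows "spray_field (sq Fb) p = 2 * E p * (F p * F p * F p) * b p"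
proof -
  have "spray_field (sq Fb) p = E p * spray_field (sq F) p + 2 * E p * sq F p * spray_field phi p"
    using p by (simp add: spray_field_def sq_Fb pd_simps smooth_simps pd_E algebra_simps)
  then show ?thesis using p by (simp add: spray_field_sq cm1_spray_field sq_apply)
qed

lemma delta_sq_Fb:
  assumes p: "p \<in> A"
  shows "delta F i (sq Fb) p = 2 * E p * (F p)\<^sup>2 * (b p * l i p + c p * m i p)"
proof -
  have "delta F i (sq Fb) p = E p * delta F i (sq F) p + 2 * E p * sq F p * delta F i phi p"
    using p by (simp add: delta_eq sq_Fb pd_simps smooth_simps pd_E algebra_simps)
  then show ?thesis using p by (simp add: delta_sq delta_decomp[of p i phi] sq_apply power2_eq_square)
qed

lemma spray_lo_Fb:
  assumes p: "p \<in> A"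
  shows "spray_lo Fb i p = 4 * (gmat Fb p $ i $ 1 * G 1 p + gmat Fb p $ i $ 2 * G 2 p)
    + E p * (F p)\<^sup>2 * (2 * b p * l i p + (4 * a p * b p + 2 * d b p - 4 * c p) * m i p)"
proof -
  have s: "smooth_on A (sq Fb)" by (simp add: sq_Fb smooth_simps)
  have Db: "Dy i b p = d b p * m i p / F p"
    by (rule Dy_Euler_0[OF _ p]) (simp add: Euler_cm)
  have "Dy i (spray_field (sq Fb)) p = Dy i (\<lambda>p. 2 * E p * (F p * F p * F p) * b p) p"
    by (rule pd_cong[OF open_A p]) (rule spray_field_sq_Fb)
  also have "\<dots> = E p * (F p)\<^sup>2 * (6 * b p * l i p + (4 * a p * b p + 2 * d b p) * m i p)"
    using p by (simp add: pd_simps smooth_simps pd_E Dy_F Dy_phi Db field_simps power2_eq_square)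
  finally have "Dy i (spray_field (sq Fb)) p - 2 * delta F i (sq Fb) p
      = E p * (F p)\<^sup>2 * (2 * b p * l i p + (4 * a p * b p + 2 * d b p - 4 * c p) * m i p)"
    by (simp add: delta_sq_Fb[OF p] algebra_simps)
  then show ?thesis
    using spray_commutator[OF s p, of i] by (simp add: spray_lo_def sum_2 gmat_def)
qed

lemma spray_Fb:
  assumes p: "p \<in> A"
  shows "spray Fb i p = G i p + V i p"
proof (rule spray_unique[OF det_gmat_Fb[OF p]])
  fix i
  have "gmat Fb p $ i $ 1 * V 1 p + gmat Fb p $ i $ 2 * V 2 p
    = E p * ((P p * (lu 1 p * l 1 p + lu 2 p * l 2 p) + Q p * (mu 1 p * l 1 p + mu 2 p * l 2 p)) * (l i p + a p * m i p)
     + (P p * (lu 1 p * m 1 p + lu 2 p * m 2 p) + Q p * (mu 1 p * m 1 p + mu 2 p * m 2 p))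
        * (a p * l i p + (d a p + 2 * (a p)\<^sup>2 + eps) * m i p))"
    unfolding gmat_Fb[OF p] V_def by (simp add: algebra_simps)
  also have "\<dots> = E p * (P p * (l i p + a p * m i p) + Q p * eps * (a p * l i p + (D p + (a p)\<^sup>2) * m i p))"
    by (simp add: lu_l lu_m mu_l mu_m p D_def)
  also have "\<dots> = E p * (F p)\<^sup>2 / 2 * (b p * l i p + (a p * b p + W p) * m i p)"
  proof -
    define w where "w = W p / D p"
    have e: "W p = w * D p" "Q p * eps = 1/2 * (F p * F p) * w" "P p = 1/2 * (F p * F p) * (b p - a p * w)"
      using p by (simp_all add: w_def Q_eq P_eq)
    show ?thesis unfolding e by (simp add: power2_eq_square algebra_simps)
  qed
  finally show "4 * (gmat Fb p $ i $ 1 * (G 1 p + V 1 p) + gmat Fb p $ i $ 2 * (G 2 p + V 2 p)) = spray_lo Fb i p"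
    unfolding spray_lo_Fb[OF p] by (simp add: Wc_def a_def[symmetric] algebra_simps)
qed

end

context conformal_change
begin

abbreviation "M \<equiv> Mt F eps m phi"

definition "eqP = (\<lambda>p. - 3 * eps * Q p - 3 * d (d Q) p + eps * d P p + d (d (d P)) p)"
definition "eqQ = (\<lambda>p. 3 * P p + 3 * eps * d (d P) p + eps * d Q p + d (d (d Q)) p)"

lemma d_frame_comb:
  assumes f: "smooth_on A f" "smooth_on A h" and p: "p \<in> A"
  shows "d (\<lambda>p. f p * lu i p + h p * mu i p) p = (d f p - h p) * lu i p + (eps * f p + d h p) * mu i p"
  using f p by (simp add: d_add d_mult smooth_simps d_lu d_mu algebra_simps)

lemma d_V: "p \<in> A \<Longrightarrow> d (V i) p = (d P p - Q p) * lu i p + (eps * P p + d Q p) * mu i p"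
  unfolding V_def by (rule d_frame_comb) simp_all

lemma d_d_V:
  assumes p: "p \<in> A"
  shows "d (d (V i)) p = (d (d P) p - 2 * d Q p - eps * P p) * lu i p + (2 * eps * d P p - eps * Q p + d (d Q) p) * mu i p"
proof -
  have "d (d (V i)) p = d (\<lambda>p. (d P p - Q p) * lu i p + (eps * P p + d Q p) * mu i p) p"
    by (rule d_cong[OF _ p]) (rule d_V)
  also have "\<dots> = (d (\<lambda>p. d P p - Q p) p - (eps * P p + d Q p)) * lu i p
      + (eps * (d P p - Q p) + d (\<lambda>p. eps * P p + d Q p) p) * mu i p"
    by (rule d_frame_comb[OF _ _ p]) (simp_all add: smooth_simps)
  finally show ?thesis
    using p by (simp add: d_add d_diff d_mult d_const smooth_simps algebra_simps)
qed

lemma d_d_d_V: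
  assumes p: "p \<in> A"
  shows "d (d (d (V i))) p + 4 * eps * d (V i) p = eqP p * lu i p + eqQ p * mu i p"
proof -
  have "d (d (d (V i))) p = d (\<lambda>p. (d (d P) p - 2 * d Q p - eps * P p) * lu i p + (2 * eps * d P p - eps * Q p + d (d Q) p) * mu i p) p"
    by (rule d_cong[OF _ p]) (rule d_d_V)
  also have "\<dots> = (d (\<lambda>p. d (d P) p - 2 * d Q p - eps * P p) p - (2 * eps * d P p - eps * Q p + d (d Q) p)) * lu i p
      + (eps * (d (d P) p - 2 * d Q p - eps * P p) + d (\<lambda>p. 2 * eps * d P p - eps * Q p + d (d Q) p) p) * mu i p"
    by (rule d_frame_comb[OF _ _ p]) (simp_all add: smooth_simps)
  finally show ?thesis
    using p by (simp add: d_V d_add d_diff d_mult d_const smooth_simps eqP_def eqQ_def algebra_simps)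
qed

lemma M_V:
  assumes p: "p \<in> A"
  shows "M i j k p = (2 * V i p * l j p * l k p + d (V i) p * (l j p * m k p + l k p * m j p)
    + (2 * eps * V i p + d (d (V i)) p) * m j p * m k p) / (F p)\<^sup>2"
  unfolding d_d_V[OF p] d_V[OF p] Mt_def Let_def times_divide_eq_left mult_1
  by (rule arg_cong[where f="\<lambda>x. x / (F p)\<^sup>2"]) (simp add: V_def algebra_simps)

lemma Dy_Euler_2: "Euler A 2 f \<Longrightarrow> p \<in> A \<Longrightarrow> Dy i f p = (2 * f p * l i p + d f p * m i p) / F p"
  by (simp add: Dy_decomp Euler_def)

lemma Dy_Dy_V:
  assumes p: "p \<in> A"
  shows "Dy j (Dy k (V i)) p = M i j k p"
proof -
  have "Dy j (Dy k (V i)) p = Dy j (\<lambda>p. (2 * V i p * l k p + d (V i) p * m k p) / F p) p"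
    by (rule pd_cong[OF open_A p]) (rule Dy_Euler_2[OF Euler_V])
  also have "\<dots> = M i j k p"
    using p by (simp add: M_V pd_simps smooth_simps Dy_F Dy_l Dy_m Dy_Euler_2[OF Euler_V]
        Dy_Euler_2[OF Euler_d[OF smooth_V Euler_V]] field_simps power2_eq_square)
  finally show ?thesis .
qed

lemma smooth_M [simp]: "smooth_on A (M i j k)"
  by (rule smooth_on_cong[OF open_A, of "Dy j (Dy k (V i))"]) (simp_all add: Dy_Dy_V smooth_simps)

lemma Euler_M: "Euler A 0 (M i j k)"
proof (rule Euler_cong)
  show "Euler A 0 (Dy j (Dy k (V i)))"
    by (rule Euler_Dy[OF _ Euler_Dy[OF _ Euler_V refl]]) (simp_all add: smooth_simps)
qed (simp add: Dy_Dy_V)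

lemma d_div_FF:
  assumes "smooth_on A f" "p \<in> A"
  shows "d (\<lambda>p. f p / (F p)\<^sup>2) p = d f p / (F p)\<^sup>2"
proof -
  have "d f p = d (\<lambda>p. f p / (F p)\<^sup>2 * (F p * F p)) p"
    using assms by (intro d_cong) (simp_all add: power2_eq_square)
  also have "\<dots> = d (\<lambda>p. f p / (F p)\<^sup>2) p * (F p * F p)"
    using assms by (subst d_mult) (simp_all add: d_mult d_F smooth_simps)
  finally show ?thesis using assms by (simp add: power2_eq_square)
qed

lemma d_M:
  assumes p: "p \<in> A"
  shows "d (M i j k) p = (eqP p * lu i p + eqQ p * mu i p) * m j p * m k p / (F p)\<^sup>2"
proof -
  have "d (M i j k) p = d (\<lambda>p. (2 * V i p * l j p * l k p + d (V i) p * (l j p * m k p + l k p * m j p)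
    + (2 * eps * V i p + d (d (V i)) p) * m j p * m k p) / (F p)\<^sup>2) p"
    by (rule d_cong[OF _ p]) (rule M_V)
  also have "\<dots> = d (\<lambda>p. 2 * V i p * l j p * l k p + d (V i) p * (l j p * m k p + l k p * m j p)
    + (2 * eps * V i p + d (d (V i)) p) * m j p * m k p) p / (F p)\<^sup>2"
    by (rule d_div_FF[OF _ p]) (simp add: smooth_simps)
  also have "d (\<lambda>p. 2 * V i p * l j p * l k p + d (V i) p * (l j p * m k p + l k p * m j p)
    + (2 * eps * V i p + d (d (V i)) p) * m j p * m k p) p = (d (d (d (V i))) p + 4 * eps * d (V i) p) * m j p * m k p"
    using p by (simp add: d_add d_mult d_const smooth_simps d_l d_m algebra_simps)
  finally show ?thesis unfolding d_d_d_V[OF p] .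
qed

lemma indep_M_iff: "(\<forall>i j k. indep_of_y A (M i j k)) \<longleftrightarrow> (\<forall>p\<in>A. eqP p = 0 \<and> eqQ p = 0)"
proof
  assume L: "\<forall>i j k. indep_of_y A (M i j k)"
  show "\<forall>p\<in>A. eqP p = 0 \<and> eqQ p = 0"
  proof
    fix p assume p: "p \<in> A"
    have "d (M i j k) p = 0" for i j k
      using Dy_eq_0_if_indep_of_y[OF open_A _ p] L by (simp add: d_eq)
    moreover obtain j where "m j p \<noteq> 0" using m_not_all_0[OF p] by blast
    ultimately have z: "eqP p * lu i p + eqQ p * mu i p = 0" for i
      using d_M[OF p, of i j j] p by simp
    have "eqP p * (lu 1 p * l 1 p + lu 2 p * l 2 p) + eqQ p * (mu 1 p * l 1 p + mu 2 p * l 2 p)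
      = (eqP p * lu 1 p + eqQ p * mu 1 p) * l 1 p + (eqP p * lu 2 p + eqQ p * mu 2 p) * l 2 p"
     "eqP p * (lu 1 p * m 1 p + lu 2 p * m 2 p) + eqQ p * (mu 1 p * m 1 p + mu 2 p * m 2 p)
      = (eqP p * lu 1 p + eqQ p * mu 1 p) * m 1 p + (eqP p * lu 2 p + eqQ p * mu 2 p) * m 2 p"
      by (simp_all add: algebra_simps)
    then show "eqP p = 0 \<and> eqQ p = 0"
      unfolding z lu_l[OF p] lu_m[OF p] mu_l[OF p] mu_m[OF p] by simp
  qed
next
  assume R: "\<forall>p\<in>A. eqP p = 0 \<and> eqQ p = 0"
  have "Dy n (M i j k) p = 0" if "p \<in> A" for n i j k p
    using R that by (simp add: Dy_Euler_0[OF Euler_M] d_M)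
  then show "\<forall>i j k. indep_of_y A (M i j k)"
    by (intro allI indep_of_y_if_Dy_eq_0) simp_all
qed

lemma V_M:
  assumes p: "p \<in> A"
  shows "V i p = (\<Sum>j\<in>UNIV. \<Sum>k\<in>UNIV. 1/2 * M i j k p * snd p $ j * snd p $ k)"
proof -
  have 1: "snd p $ 1 * Dy 1 (V i) p + snd p $ 2 * Dy 2 (V i) p = 2 * V i p"
    using Euler_V p by (simp add: Euler_def sc1_def sum_2)
  have "Euler A 1 (Dy k (V i))" for k by (rule Euler_Dy[OF _ Euler_V]) simp_all
  then have 2: "snd p $ 1 * M i 1 k p + snd p $ 2 * M i 2 k p = Dy k (V i) p" for k
    using p by (simp add: Euler_def sc1_def sum_2 Dy_Dy_V)
  show ?thesis using 1 unfolding 2[symmetric] by (simp add: sum_2 algebra_simps)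
qed

lemma indep_M_iff_Berwald: "(\<forall>i j k. indep_of_y A (M i j k)) \<longleftrightarrow> (\<forall>i. quadratic_in_y A (spray Fb i))"
proof
  assume L: "\<forall>i j k. indep_of_y A (M i j k)"
  show "\<forall>i. quadratic_in_y A (spray Fb i)"
  proof
    fix i
    have "indep_of_y A (\<lambda>p. 1/2 * M i j k p)" for j k
      using L unfolding indep_of_y_def by metis
    then have "quadratic_in_y A (V i)"
      by (rule quadratic_in_y_if_indep_coeffs) (rule V_M)
    then have "quadratic_in_y A (\<lambda>p. G i p + 1 * V i p)"
      by (intro quadratic_in_y_add_scaled quadratic_G)
    then show "quadratic_in_y A (spray Fb i)"
      by (rule quadratic_in_y_cong) (simp add: spray_Fb)
  qed
next
  assume R: "\<forall>i. quadratic_in_y A (spray Fb i)"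
  show "\<forall>i j k. indep_of_y A (M i j k)"
  proof (intro allI)
    fix i j k
    have "quadratic_in_y A (\<lambda>p. spray Fb i p + (-1) * G i p)"
      using R by (intro quadratic_in_y_add_scaled quadratic_G) simp
    then have "quadratic_in_y A (V i)"
      by (rule quadratic_in_y_cong) (simp add: spray_Fb)
    then have "indep_of_y A (Dy j (Dy k (V i)))"
      by (rule Dy_Dy_quadratic_in_y[OF open_A])
    then show "indep_of_y A (M i j k)"
      by (rule indep_of_y_cong) (simp add: Dy_Dy_V)
  qed
qed

end

theorem theorem3p8:
  fixes A :: "pt set" and F :: fn and eps :: real and m :: "2 \<Rightarrow> fn" and phi :: fn
  assumes Finsler: "conic_pseudo_Finsler A F"
    and Riemannian: "quadratic_in_y A (sq F)"
    and frame: "berwald_frame A F eps m"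
    and conf: "conf_admissible A F eps m phi"
  defines "P \<equiv> Pc F eps m phi" and "Q \<equiv> Qc F eps m phi" and "d \<equiv> sc2 F eps m"
  shows "((\<forall>p\<in>A. - 3 * eps * Q p - 3 * d (d Q) p + eps * d P p + d (d (d P)) p = 0 \<and>
                 3 * P p + 3 * eps * d (d P) p + eps * d Q p + d (d (d Q)) p = 0)
          \<longleftrightarrow> (\<forall>i j k. indep_of_y A (Mt F eps m phi i j k)))
       \<and> ((\<forall>i j k. indep_of_y A (Mt F eps m phi i j k))
          \<longleftrightarrow> (\<forall>i. quadratic_in_y A (spray (\<lambda>p. exp (phi p) * F p) i)))"
proof -
  interpret conformal_change A F eps m phi
    using Finsler Riemannian frame conf by unfold_locales
  show ?thesis
    using indep_M_iff indep_M_iff_Berwald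
    unfolding eqP_def eqQ_def Fb_def P_def Q_def d_def by blast
qed

end
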